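(* The space $(A^1)^\perp+C$ is a proper, closed subspace of $L^\infty$.
   Context: $D$ is the open unit disc in $\mathbb{C}$, $dA=\frac1\pi r\,dr\,d\theta$ is normalized Lebesgue measure on $D$, and $L^\infty=L^\infty(D,dA)$ (complex-valued). The Bergman space $A^1$ is the Banach space of holomorphic functions $f$ on $D$ with $\|f\|=\int_D|f|\,dA<\infty$. The annihilator is $(A^1)^\perp=\{\psi\in L^\infty:\int_D f\overline{\psi}\,dA=0\text{ for all }f\in A^1\}$. $C=C(\overline{D})$ is the space of continuous complex functions on $\overline{D}$, regarded as a subspace of $L^\infty$. $(A^1)^\perp+C$ denotes the sum of these two subspaces. *)

theory Defs
  imports "HOL-Probability.Essential_Supremum" "HOL-Library.Set_Algebras"
begin

abbreviation unit_disc :: "complex set"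
  where "unit_disc \<equiv> ball 0 1"

definition dA :: "complex measure"
  where "dA = density (lebesgue_on unit_disc) (\<lambda>_. ennreal (1 / pi))"

lemma space_dA [simp]: "space dA = unit_disc"
  by (simp add: dA_def)

lemma sets_dA [measurable_cong]: "sets dA = sets (lebesgue_on unit_disc)"
  by (simp add: dA_def)

lemma emeasure_dA_disc: "emeasure dA unit_disc = 1"
proof -
  have "emeasure lborel unit_disc = ennreal pi"
    using emeasure_ball[of 1 "0 :: complex"] by (simp add: unit_ball_vol_2)
  then have "emeasure lebesgue unit_disc = ennreal pi"
    by (simp add: emeasure_completion)
  then have "emeasure (lebesgue_on unit_disc) unit_disc = ennreal pi"
    by (subst emeasure_restrict_space) auto
  moreover have "unit_disc \<in> sets (lebesgue_on unit_disc)"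
    using sets.top[of "lebesgue_on unit_disc"] by simp
  ultimately show ?thesis
    unfolding dA_def
    by (subst emeasure_density_const) (auto simp flip: ennreal_mult)
qed


section \<open>The normed space \<open>L\<^sup>\<infinity>(D, dA)\<close>\<close>

definition ess_norm :: "(complex \<Rightarrow> complex) \<Rightarrow> ennreal"
  where "ess_norm f = esssup dA (\<lambda>z. ennreal (cmod (f z)))"

definition ess_bounded :: "(complex \<Rightarrow> complex) \<Rightarrow> bool"
  where "ess_bounded f \<longleftrightarrow> f \<in> borel_measurable dA \<and> ess_norm f < \<infinity>"

lemma ess_bounded_measurable [measurable_dest]: "ess_bounded f \<Longrightarrow> f \<in> borel_measurable dA"
  by (simp add: ess_bounded_def)

lemma ess_norm_le_iff:
  assumes "f \<in> borel_measurable dA" "0 \<le> c"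
  shows "ess_norm f \<le> ennreal c \<longleftrightarrow> (AE z in dA. cmod (f z) \<le> c)"
proof
  assume *: "ess_norm f \<le> ennreal c"
  have "AE z in dA. ennreal (cmod (f z)) \<le> ess_norm f"
    unfolding ess_norm_def by (rule esssup_AE)
  then show "AE z in dA. cmod (f z) \<le> c"
  proof (rule eventually_mono)
    fix z assume "ennreal (cmod (f z)) \<le> ess_norm f"
    then have "ennreal (cmod (f z)) \<le> ennreal c" using * by (rule order_trans)
    then show "cmod (f z) \<le> c" using assms(2) by simp
  qed
next
  assume *: "AE z in dA. cmod (f z) \<le> c"
  show "ess_norm f \<le> ennreal c"
    unfolding ess_norm_def
  proof (rule esssup_I)
    show "(\<lambda>z. ennreal (cmod (f z))) \<in> borel_measurable dA"
      using assms(1) by measurable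
    show "AE z in dA. ennreal (cmod (f z)) \<le> ennreal c"
      using * by (rule eventually_mono) (rule ennreal_leI)
  qed
qed

lemma ess_boundedI:
  assumes "f \<in> borel_measurable dA" "AE z in dA. cmod (f z) \<le> c"
  shows "ess_bounded f"
proof -
  have "AE z in dA. cmod (f z) \<le> max 0 c"
    using assms(2) by (rule eventually_mono) simp
  then have "ess_norm f \<le> ennreal (max 0 c)"
    using ess_norm_le_iff[OF assms(1), of "max 0 c"] by simp
  also have "\<dots> < \<infinity>" by simp
  finally show ?thesis using assms(1) by (simp add: ess_bounded_def)
qed

lemma enn2real_ess_norm_le_iff:
  assumes "ess_bounded f" "0 \<le> c"
  shows "enn2real (ess_norm f) \<le> c \<longleftrightarrow> (AE z in dA. cmod (f z) \<le> c)"
proof -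
  have "enn2real (ess_norm f) \<le> c \<longleftrightarrow> ess_norm f \<le> ennreal c"
    using assms by (cases "ess_norm f") (auto simp: ess_bounded_def)
  then show ?thesis
    using ess_norm_le_iff assms by (simp add: ess_bounded_def)
qed

lemma ess_norm_AE:
  assumes "ess_bounded f"
  shows "AE z in dA. cmod (f z) \<le> enn2real (ess_norm f)"
  using enn2real_ess_norm_le_iff[OF assms, of "enn2real (ess_norm f)"] by simp

lemma ess_bounded_const: "ess_bounded (\<lambda>_. c)"
  by (rule ess_boundedI[of _ "cmod c"]) auto

lemma ess_bounded_add:
  assumes "ess_bounded f" "ess_bounded g"
  shows "ess_bounded (\<lambda>z. f z + g z)"
proof (rule ess_boundedI)
  show "(\<lambda>z. f z + g z) \<in> borel_measurable dA" using assms by measurable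
  show "AE z in dA. cmod (f z + g z) \<le> enn2real (ess_norm f) + enn2real (ess_norm g)"
    using ess_norm_AE[OF assms(1)] ess_norm_AE[OF assms(2)]
    by eventually_elim (meson norm_triangle_le add_mono)
qed

lemma ess_bounded_cmult:
  assumes "ess_bounded f"
  shows "ess_bounded (\<lambda>z. c * f z)"
proof (rule ess_boundedI)
  show "(\<lambda>z. c * f z) \<in> borel_measurable dA" using assms by measurable
  show "AE z in dA. cmod (c * f z) \<le> cmod c * enn2real (ess_norm f)"
    using ess_norm_AE[OF assms]
    by eventually_elim (simp add: norm_mult mult_left_mono)
qed

lemma ess_bounded_uminus: "ess_bounded f \<Longrightarrow> ess_bounded (\<lambda>z. - f z)"
  using ess_bounded_cmult[of f "-1"] by simp

lemma ess_bounded_diff: "ess_bounded f \<Longrightarrow> ess_bounded g \<Longrightarrow> ess_bounded (\<lambda>z. f z - g z)"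
  using ess_bounded_add[of f "\<lambda>z. - g z"] ess_bounded_uminus[of g] by simp

lemma ess_bounded_scaleR: "ess_bounded f \<Longrightarrow> ess_bounded (\<lambda>z. r *\<^sub>R f z)"
  using ess_bounded_cmult[of f "of_real r"] by (simp add: scaleR_conv_of_real)

lemma ess_bounded_continuous:
  assumes "continuous_on (cball 0 1) g"
  shows "ess_bounded g"
proof -
  have "bounded (g ` cball 0 1)"
    using assms by (intro compact_imp_bounded compact_continuous_image) auto
  then obtain B where B: "\<And>z. z \<in> cball 0 1 \<Longrightarrow> cmod (g z) \<le> B"
    unfolding bounded_iff by blast
  have "continuous_on unit_disc g"
    using assms by (rule continuous_on_subset) auto
  then have "g \<in> borel_measurable (lebesgue_on unit_disc)"
    by (rule continuous_imp_measurable_on_sets_lebesgue) auto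
  then have "g \<in> borel_measurable dA"
    by (simp add: dA_def)
  moreover have "AE z in dA. cmod (g z) \<le> B"
    by (rule AE_I2) (use B in auto)
  ultimately show ?thesis by (rule ess_boundedI)
qed

definition Linf_rel :: "(complex \<Rightarrow> complex) \<Rightarrow> (complex \<Rightarrow> complex) \<Rightarrow> bool"
  where "Linf_rel f g \<longleftrightarrow> ess_bounded f \<and> ess_bounded g \<and> (AE z in dA. f z = g z)"

lemma part_equivp_Linf_rel: "part_equivp Linf_rel"
proof (rule part_equivpI)
  show "\<exists>f. Linf_rel f f"
    using ess_bounded_const[of 0] by (auto simp: Linf_rel_def)
  show "symp Linf_rel"
    by (auto simp: symp_def Linf_rel_def elim: eventually_mono)
  show "transp Linf_rel"
  proof (rule transpI)
    fix f g h assume "Linf_rel f g" "Linf_rel g h"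
    then show "Linf_rel f h"
      unfolding Linf_rel_def by (auto elim: eventually_elim2)
  qed
qed

quotient_type Linf = "complex \<Rightarrow> complex" / partial: Linf_rel
  by (rule part_equivp_Linf_rel)

lemma Linf_relD:
  assumes "Linf_rel f g"
  shows "ess_bounded f" "ess_bounded g" "AE z in dA. f z = g z"
  using assms by (auto simp: Linf_rel_def)

lemma Linf_rel_ess_norm:
  assumes "Linf_rel f g"
  shows "ess_norm f = ess_norm g"
  unfolding ess_norm_def
proof (rule esssup_AE_cong)
  show "(\<lambda>z. ennreal (cmod (f z))) \<in> borel_measurable dA"
    "(\<lambda>z. ennreal (cmod (g z))) \<in> borel_measurable dA"
    using Linf_relD(1,2)[OF assms] by measurable
  show "AE z in dA. ennreal (cmod (f z)) = ennreal (cmod (g z))"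
    using Linf_relD(3)[OF assms] by eventually_elim simp
qed

lift_definition scaleC_Linf :: "complex \<Rightarrow> Linf \<Rightarrow> Linf" is "\<lambda>c f z. c * f z"
  unfolding Linf_rel_def by (auto intro: ess_bounded_cmult elim: eventually_mono)

instantiation Linf :: real_normed_vector
begin

lift_definition zero_Linf :: Linf is "\<lambda>_. 0"
  by (simp add: Linf_rel_def ess_bounded_const)

lift_definition plus_Linf :: "Linf \<Rightarrow> Linf \<Rightarrow> Linf" is "\<lambda>f g z. f z + g z"
  unfolding Linf_rel_def by (auto intro: ess_bounded_add elim: eventually_elim2)

lift_definition uminus_Linf :: "Linf \<Rightarrow> Linf" is "\<lambda>f z. - f z"
  unfolding Linf_rel_def by (auto intro: ess_bounded_uminus elim: eventually_mono)

lift_definition minus_Linf :: "Linf \<Rightarrow> Linf \<Rightarrow> Linf" is "\<lambda>f g z. f z - g z"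
  unfolding Linf_rel_def by (auto intro: ess_bounded_diff elim: eventually_elim2)

lift_definition scaleR_Linf :: "real \<Rightarrow> Linf \<Rightarrow> Linf" is "\<lambda>r f z. r *\<^sub>R f z"
  unfolding Linf_rel_def by (auto intro: ess_bounded_scaleR elim: eventually_mono)

lift_definition norm_Linf :: "Linf \<Rightarrow> real" is "\<lambda>f. enn2real (ess_norm f)"
  by (simp add: Linf_rel_ess_norm)

definition dist_Linf :: "Linf \<Rightarrow> Linf \<Rightarrow> real"
  where "dist_Linf f g = norm (f - g)"

definition sgn_Linf :: "Linf \<Rightarrow> Linf"
  where "sgn_Linf f = inverse (norm f) *\<^sub>R f"

definition uniformity_Linf :: "(Linf \<times> Linf) filter"
  where "uniformity_Linf = (INF e\<in>{0 <..}. principal {(f, g). dist f g < e})"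

definition open_Linf :: "Linf set \<Rightarrow> bool"
  where "open_Linf U \<longleftrightarrow> (\<forall>f\<in>U. eventually (\<lambda>(f', g). f' = f \<longrightarrow> g \<in> U) uniformity)"

lemma norm_Linf_cmult:
  assumes "ess_bounded f"
  shows "enn2real (ess_norm (\<lambda>z. c * f z)) = cmod c * enn2real (ess_norm f)"
proof (cases "c = 0")
  case True
  have "enn2real (ess_norm (\<lambda>z. 0)) \<le> 0"
    by (subst enn2real_ess_norm_le_iff) (auto intro: ess_bounded_const)
  then show ?thesis
    using True enn2real_nonneg[of "ess_norm (\<lambda>z. 0)"] by simp
next
  case False
  have le: "enn2real (ess_norm (\<lambda>z. a * g z)) \<le> cmod a * enn2real (ess_norm g)"
    if "ess_bounded g" for a g
    using ess_norm_AE[OF that]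
    by (subst enn2real_ess_norm_le_iff)
       (auto intro!: ess_bounded_cmult that mult_left_mono elim!: eventually_mono simp: norm_mult)
  have "enn2real (ess_norm f) \<le> cmod (inverse c) * enn2real (ess_norm (\<lambda>z. c * f z))"
    using le[OF ess_bounded_cmult[OF assms, of c], of "inverse c"] False
    by (simp flip: mult.assoc)
  then have "cmod c * enn2real (ess_norm f) \<le> enn2real (ess_norm (\<lambda>z. c * f z))"
    using False by (simp add: norm_divide field_simps)
  then show ?thesis using le[OF assms, of c] by simp
qed

instance
proof
  fix f g h :: Linf and r s :: real and U :: "Linf set"
  show "f + g + h = f + (g + h)"
    by transfer (auto simp: Linf_rel_def add.assoc intro: ess_bounded_add)
  show "f + g = g + f"
    by transfer (auto simp: Linf_rel_def add.commute intro: ess_bounded_add)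
  show "0 + f = f"
    by transfer (auto simp: Linf_rel_def)
  show "- f + f = 0"
    by transfer (auto simp: Linf_rel_def ess_bounded_const)
  show "f - g = f + - g"
    by transfer (auto simp: Linf_rel_def intro: ess_bounded_diff)
  show "r *\<^sub>R (f + g) = r *\<^sub>R f + r *\<^sub>R g"
    by transfer (auto simp: Linf_rel_def scaleR_add_right intro: ess_bounded_add ess_bounded_scaleR)
  show "(r + s) *\<^sub>R f = r *\<^sub>R f + s *\<^sub>R f"
    by transfer (auto simp: Linf_rel_def scaleR_add_left intro: ess_bounded_add ess_bounded_scaleR)
  show "r *\<^sub>R s *\<^sub>R f = (r * s) *\<^sub>R f"
    by transfer (auto simp: Linf_rel_def intro: ess_bounded_scaleR)
  show "1 *\<^sub>R f = f"
    by transfer (auto simp: Linf_rel_def)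
  show "dist f g = norm (f - g)"
    by (rule dist_Linf_def)
  show "sgn f = inverse (norm f) *\<^sub>R f"
    by (rule sgn_Linf_def)
  show "uniformity = (INF e\<in>{0 <..}. principal {(f, g :: Linf). dist f g < e})"
    by (rule uniformity_Linf_def)
  show "open U \<longleftrightarrow> (\<forall>f\<in>U. eventually (\<lambda>(f', g). f' = f \<longrightarrow> g \<in> U) uniformity)"
    by (rule open_Linf_def)
  show "norm f = 0 \<longleftrightarrow> f = 0"
  proof transfer
    fix f assume f: "Linf_rel f f"
    note f' = Linf_relD(1)[OF f]
    have "enn2real (ess_norm f) = 0 \<longleftrightarrow> enn2real (ess_norm f) \<le> 0"
      using enn2real_nonneg[of "ess_norm f"] by linarith
    also have "\<dots> \<longleftrightarrow> (AE z in dA. f z = 0)"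
      by (subst enn2real_ess_norm_le_iff[OF f']) auto
    finally show "enn2real (ess_norm f) = 0 \<longleftrightarrow> Linf_rel f (\<lambda>_. 0)"
      using f' by (auto simp: Linf_rel_def ess_bounded_const)
  qed
  show "norm (f + g) \<le> norm f + norm g"
  proof transfer
    fix f g assume "Linf_rel f f" "Linf_rel g g"
    then have f: "ess_bounded f" and g: "ess_bounded g"
      by (auto dest: Linf_relD)
    have "AE z in dA. cmod (f z + g z) \<le> enn2real (ess_norm f) + enn2real (ess_norm g)"
      using ess_norm_AE[OF f] ess_norm_AE[OF g]
      by eventually_elim (meson norm_triangle_le add_mono)
    then show "enn2real (ess_norm (\<lambda>z. f z + g z)) \<le> enn2real (ess_norm f) + enn2real (ess_norm g)"
      by (subst enn2real_ess_norm_le_iff) (auto intro: ess_bounded_add f g)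
  qed
  show "norm (r *\<^sub>R f) = \<bar>r\<bar> * norm f"
    by transfer (auto simp: scaleR_conv_of_real norm_Linf_cmult dest: Linf_relD)
qed

end

text \<open>
  The distribution has no type class of complex normed spaces, so the complex vector space
  structure is added to the real one: \<open>Linf.subspace\<close> below refers to complex linear subspaces,
  whereas the plain \<open>subspace\<close> is only about real scalars.
\<close>

interpretation Linf: vector_space scaleC_Linf
proof
  fix a b :: complex and f g :: Linf
  show "scaleC_Linf a (f + g) = scaleC_Linf a f + scaleC_Linf a g"
    by transfer (auto simp: Linf_rel_def distrib_left intro: ess_bounded_add ess_bounded_cmult)
  show "scaleC_Linf (a + b) f = scaleC_Linf a f + scaleC_Linf b f"
    by transfer (auto simp: Linf_rel_def distrib_right intro: ess_bounded_add ess_bounded_cmult)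
  show "scaleC_Linf a (scaleC_Linf b f) = scaleC_Linf (a * b) f"
    by transfer (auto simp: Linf_rel_def mult.assoc intro!: ess_bounded_cmult)
  show "scaleC_Linf 1 f = f"
    by transfer (auto simp: Linf_rel_def)
qed

lemma scaleC_Linf_of_real: "scaleC_Linf (of_real r) f = r *\<^sub>R f"
  by transfer (auto simp: Linf_rel_def scaleR_conv_of_real intro!: ess_bounded_cmult)

lemma norm_scaleC_Linf: "norm (scaleC_Linf c f) = cmod c * norm f"
  by transfer (auto simp: norm_Linf_cmult dest: Linf_relD)


section \<open>The Bergman space, its annihilator, and the continuous functions\<close>

definition bergman_A1 :: "(complex \<Rightarrow> complex) set"
  where "bergman_A1 = {f. f holomorphic_on unit_disc \<and> integrable dA f}"

lift_definition annihilates_A1 :: "Linf \<Rightarrow> bool"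
  is "\<lambda>\<psi>. \<forall>f\<in>bergman_A1. (LINT z|dA. f z * cnj (\<psi> z)) = 0"
proof -
  fix \<psi> \<phi> assume *: "Linf_rel \<psi> \<phi>"
  note [measurable] = Linf_relD(1,2)[OF *]
  have "(LINT z|dA. f z * cnj (\<psi> z)) = (LINT z|dA. f z * cnj (\<phi> z))"
    if "f \<in> bergman_A1" for f
  proof (rule integral_cong_AE)
    have [measurable]: "f \<in> borel_measurable dA"
      using that by (simp add: bergman_A1_def borel_measurable_integrable)
    have [measurable]: "cnj \<in> borel_measurable borel"
      by (intro borel_measurable_continuous_onI continuous_intros)
    show "(\<lambda>z. f z * cnj (\<psi> z)) \<in> borel_measurable dA"
      "(\<lambda>z. f z * cnj (\<phi> z)) \<in> borel_measurable dA"
      by measurable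
    show "AE z in dA. f z * cnj (\<psi> z) = f z * cnj (\<phi> z)"
      using Linf_relD(3)[OF *] by eventually_elim simp
  qed
  then show "(\<forall>f\<in>bergman_A1. (LINT z|dA. f z * cnj (\<psi> z)) = 0) \<longleftrightarrow>
    (\<forall>f\<in>bergman_A1. (LINT z|dA. f z * cnj (\<phi> z)) = 0)"
    by simp
qed

definition A1_perp :: "Linf set"
  where "A1_perp = {\<psi>. annihilates_A1 \<psi>}"

text \<open>
  By \<open>ess_bounded_continuous\<close>, \<open>abs_Linf\<close> is applied only to functions in its proper domain.
\<close>

definition C_closed_disc :: "Linf set"
  where "C_closed_disc = abs_Linf ` {g. continuous_on (cball 0 1) g}"

end

theory Submission
  imports Defs "HOL-Complex_Analysis.Cauchy_Integral_Formula" "HOL-Probability.Distribution_Functions"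
begin

text \<open>
  Put \<open>Q \<phi> w = 3 (1 - |w|\<^sup>2)\<^sup>2 \<integral> \<phi>(z) (1 - w cnj z)\<^sup>-\<^sup>4 dA(z)\<close>. Since
  \<open>\<integral> |1 - w cnj z|\<^sup>-\<^sup>4 dA(z) = (1 - |w|\<^sup>2)\<^sup>-\<^sup>2\<close>, the operator \<open>Q\<close> is bounded on \<open>L\<^sup>\<infinity>\<close>. It kills
  \<open>(A\<^sup>1)\<^sup>\<bottom>\<close>, because its kernel is conjugate holomorphic in \<open>z\<close>, and \<open>\<phi> - Q \<phi>\<close> always lies in \<open>(A\<^sup>1)\<^sup>\<bottom>\<close>,
  by Fubini's theorem and the weighted reproducing formula
  \<open>f z = 3 \<integral> f(w) (1 - |w|\<^sup>2)\<^sup>2 (1 - z cnj w)\<^sup>-\<^sup>4 dA(w)\<close>. As \<open>Q 1 w = 3 (1 - |w|\<^sup>2)\<^sup>2\<close> and the kernel concentrates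
  near \<open>w\<close> as \<open>|w|\<close> tends to \<open>1\<close>, \<open>Q\<close> maps \<open>C\<close> to continuous functions vanishing on the unit circle.
  Hence \<open>\<phi>\<close> lies in \<open>(A\<^sup>1)\<^sup>\<bottom> + C\<close> if and only if \<open>Q \<phi>\<close> vanishes at the circle, a condition that is linear
  and stable under uniform limits. It fails for \<open>\<phi>(z) = (1 - |z|\<^sup>2)\<^sup>2 (1 - z)\<^sup>-\<^sup>2\<close>, which is fixed by \<open>Q\<close>.
\<close>

section \<open>Rotation invariance of Lebesgue measure on the complex plane\<close>

lemma borel_measurable_cnj [measurable]: "cnj \<in> borel_measurable borel"
  by (intro borel_measurable_continuous_onI continuous_intros)

text \<open>
  The library knows the invariance of Lebesgue measure under orthogonal maps only for \<open>real^'n\<close>.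
\<close>

lemma lborel_complex_eq_distr:
  "distr lborel borel (\<lambda>x :: real^2. Complex (x $ 1) (x $ 2)) = lborel"
proof (rule lborel_eqI[symmetric])
  have c: "continuous_on UNIV (\<lambda>x :: real^2. Complex (x $ 1) (x $ 2))"
    unfolding Complex_eq by (intro continuous_intros)
  then have m [measurable]: "(\<lambda>x :: real^2. Complex (x $ 1) (x $ 2)) \<in> borel_measurable borel"
    by (rule borel_measurable_continuous_onI)
  fix l u :: complex assume le: "\<And>b. b \<in> Basis \<Longrightarrow> l \<bullet> b \<le> u \<bullet> b"
  have le': "Re l \<le> Re u" "Im l \<le> Im u"
    using le[of 1] le[of \<i>] by (auto simp: Basis_complex_def)
  define l' u' :: "real^2" where "l' = vector [Re l, Im l]" and "u' = vector [Re u, Im u]"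
  have *: "(\<lambda>x :: real^2. Complex (x $ 1) (x $ 2)) -` box l u = box l' u'"
    by (auto simp: in_box_complex_iff mem_box_cart forall_2 l'_def u'_def)
  have "l' $ i \<le> u' $ i" for i
    using le' forall_2[of "\<lambda>i. l' $ i \<le> u' $ i"] by (simp add: l'_def u'_def)
  then have "emeasure lborel (box l' u') = (\<Prod>b\<in>Basis. (u' - l') \<bullet> b)"
    by (intro emeasure_lborel_box) (auto simp: Basis_vec_def inner_axis)
  also have "(\<Prod>b\<in>Basis. (u' - l') \<bullet> b) = (\<Prod>i\<in>UNIV. (u' - l') $ i)"
    unfolding Basis_vec_def by (subst prod.UNION_disjoint) (auto simp: axis_eq_axis inner_axis)
  finally show "emeasure (distr lborel borel (\<lambda>x :: real^2. Complex (x $ 1) (x $ 2))) (box l u)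
    = (\<Prod>b\<in>Basis. (u - l) \<bullet> b)"
    by (subst emeasure_distr) (auto simp: * l'_def u'_def Basis_complex_def UNIV_2)
qed simp

text \<open>The coordinate map \<open>T\<close> with inverse \<open>S\<close> carries the rotation
  over to \<open>real^2\<close>, where orthogonal maps are known to preserve measure. It suffices to
  compare boxes, since they determine the measure.\<close>

lemma lborel_distr_rotation:
  fixes c :: complex
  assumes "cmod c = 1"
  shows "distr lborel borel ((*) c) = lborel"
proof (rule lborel_eqI[symmetric])
  define T where "T = (\<lambda>x :: real^2. Complex (x $ 1) (x $ 2))"
  define S where "S = (\<lambda>z. vector [Re z, Im z] :: real^2)"
  have TS: "T (S z) = z" for z by (simp add: T_def S_def)
  have ST: "S (T x) = x" for x by (simp add: T_def S_def vec_eq_iff forall_2)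
  have c: "continuous_on UNIV T"
    unfolding T_def Complex_eq by (intro continuous_intros)
  then have [measurable]: "T \<in> borel_measurable borel"
    by (rule borel_measurable_continuous_onI)
  have emT: "emeasure lborel A = emeasure lborel (T -` A)" if [measurable]: "A \<in> sets borel" for A
    by (subst lborel_complex_eq_distr[symmetric], subst emeasure_distr) (auto simp flip: T_def)
  \<comment> \<open>\<open>R\<close> is the inverse rotation in coordinates: the preimage of a box
    under multiplication by \<open>c\<close> then becomes its image under \<open>R\<close>, the form
    in which orthogonal invariance applies.\<close>
  define R where "R = (\<lambda>x. S (cnj c * T x))"
  have cc: "c * cnj c = 1"
    using assms by (simp add: complex_norm_square[symmetric])
  have "linear R"
    by (rule linearI) (auto simp: R_def S_def T_def vec_eq_iff forall_2 algebra_simps)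
  moreover have "norm (R x) = norm x" for x
  proof -
    have n: "norm (S z) = cmod z" for z
      by (simp add: S_def norm_vec_def L2_set_def UNIV_2 cmod_def)
    show ?thesis
      using n[of "T x"] by (simp add: R_def n norm_mult assms ST)
  qed
  ultimately have R: "orthogonal_transformation R"
    by (simp add: orthogonal_transformation)
  fix l u :: complex assume le: "\<And>b. b \<in> Basis \<Longrightarrow> l \<bullet> b \<le> u \<bullet> b"
  have m: "(*) c -` box l u \<in> sets borel"
    using measurable_sets[of "(*) c" borel borel "box l u"] by simp
  have "bij R"
    using R orthogonal_transformation_bij by blast
  have vim: "T -` ((*) c -` box l u) = R ` (T -` box l u)"
  proof (intro equalityI subsetI)
    fix x assume "x \<in> T -` ((*) c -` box l u)"
    moreover have "R (S (c * T x)) = x"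
      using cc by (simp add: R_def TS ST mult.assoc[symmetric] mult.commute)
    ultimately show "x \<in> R ` (T -` box l u)"
      by (intro image_eqI[of _ _ "S (c * T x)"]) (auto simp: TS)
  qed (use cc in \<open>auto simp: R_def TS mult.assoc[symmetric]\<close>)
  have "T -` box l u = box (S l) (S u)"
    by (auto simp: T_def S_def in_box_complex_iff mem_box_cart forall_2)
  then have lm: "T -` box l u \<in> lmeasurable" by simp
  have "emeasure (distr lborel borel ((*) c)) (box l u) = emeasure lborel ((*) c -` box l u)"
    by (subst emeasure_distr) auto
  also have "\<dots> = emeasure lborel (T -` ((*) c -` box l u))"
    by (rule emT[OF m])
  \<comment> \<open>Invariance under orthogonal maps is used for the completed measure and for sets
    of finite measure, hence the passage to \<open>lebesgue\<close> and back.\<close>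
  also have "\<dots> = emeasure lebesgue (T -` ((*) c -` box l u))"
    using measurable_sets[OF _ m, of T borel] by (simp add: emeasure_completion)
  also have "\<dots> = emeasure lebesgue (R ` (T -` box l u))"
    by (simp only: vim)
  also have "\<dots> = emeasure lebesgue (T -` box l u)"
    using measure_orthogonal_image[OF R lm] measurable_orthogonal_image[OF R lm] lm
    by (simp add: emeasure_eq_measure2 fmeasurableD)
  also have "\<dots> = emeasure lborel (T -` box l u)"
    using \<open>T -` box l u = box (S l) (S u)\<close> by (simp add: emeasure_completion)
  also have "\<dots> = emeasure lborel (box l u)"
    by (subst emT) auto
  also have "\<dots> = (\<Prod>b\<in>Basis. (u - l) \<bullet> b)"
    by (rule emeasure_lborel_box[OF le])
  finally show "emeasure (distr lborel borel ((*) c)) (box l u) = (\<Prod>b\<in>Basis. (u - l) \<bullet> b)" .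
qed simp

section \<open>Integrals over the disc\<close>

lemma finite_measure_dA: "finite_measure dA"
  by (rule finite_measureI) (simp add: emeasure_dA_disc)

interpretation dA: finite_measure dA
  by (rule finite_measure_dA)

lemma borel_measurable_dA [measurable (raw)]:
  assumes "f \<in> borel_measurable borel"
  shows "f \<in> borel_measurable dA"
proof -
  have "f \<in> borel_measurable (lebesgue_on unit_disc)"
    using measurable_restrict_space1[OF measurable_completion[of f lborel borel]] assms by simp
  then show ?thesis by (simp add: dA_def)
qed

text \<open>For Borel integrands the completion makes no difference, so an integral over the disc
  can be transformed with the change of variables for \<open>lborel\<close>.\<close>

lemma integral_dA_borel:
  fixes f :: "complex \<Rightarrow> 'a :: {banach, second_countable_topology}"
  assumes [measurable]: "f \<in> borel_measurable borel"
  shows "integral\<^sup>L dA f = (1 / pi) *\<^sub>R (\<integral>w. indicator unit_disc w *\<^sub>R f w \<partial>lborel)"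
proof -
  have m: "f \<in> borel_measurable (lebesgue_on unit_disc)"
    using borel_measurable_dA[OF assms] by (simp add: dA_def)
  have "integral\<^sup>L dA f = (\<integral>w. (1 / pi) *\<^sub>R f w \<partial>lebesgue_on unit_disc)"
    unfolding dA_def by (subst integral_density) (use m in auto)
  also have "\<dots> = (1 / pi) *\<^sub>R (\<integral>w. f w \<partial>lebesgue_on unit_disc)"
    by simp
  also have "(\<integral>w. f w \<partial>lebesgue_on unit_disc) = (\<integral>w. indicator unit_disc w *\<^sub>R f w \<partial>lebesgue)"
    by (subst integral_restrict_space) auto
  also have "\<dots> = (\<integral>w. indicator unit_disc w *\<^sub>R f w \<partial>lborel)"
    by (rule integral_completion) (intro borel_measurable_scaleR borel_measurable_indicator, auto)
  finally show ?thesis .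
qed

lemma integral_dA_rotation:
  fixes f :: "complex \<Rightarrow> 'a :: {banach, second_countable_topology}"
  assumes [measurable]: "f \<in> borel_measurable borel" and c: "cmod c = 1"
  shows "(\<integral>w. f (c * w) \<partial>dA) = integral\<^sup>L dA f"
proof -
  have "(\<integral>w. indicator unit_disc w *\<^sub>R f w \<partial>lborel)
    = (\<integral>w. indicator unit_disc w *\<^sub>R f w \<partial>distr lborel borel ((*) c))"
    by (simp add: lborel_distr_rotation[OF c])
  also have "\<dots> = (\<integral>w. indicator unit_disc (c * w) *\<^sub>R f (c * w) \<partial>lborel)"
    by (rule integral_distr) (auto intro!: borel_measurable_scaleR borel_measurable_indicator)
  also have "\<dots> = (\<integral>w. indicator unit_disc w *\<^sub>R f (c * w) \<partial>lborel)"
    by (intro Bochner_Integration.integral_cong) (auto simp: indicator_def norm_mult c)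
  finally show ?thesis
    by (simp add: integral_dA_borel)
qed

section \<open>The distribution of the squared modulus and the radial moments\<close>

lemma emeasure_dA_cball:
  assumes "0 \<le> r" "r \<le> 1"
  shows "emeasure dA (cball 0 r \<inter> unit_disc) = ennreal (r\<^sup>2)"
proof -
  have "emeasure lborel (cball 0 r \<inter> unit_disc :: complex set) = ennreal (pi * r\<^sup>2)"
  proof (cases "r = 1")
    case True
    then have "cball 0 r \<inter> unit_disc = unit_disc" by auto
    then show ?thesis
      using emeasure_ball[of 1 "0 :: complex"] True by (simp add: unit_ball_vol_2)
  next
    case False
    then have "cball 0 r \<inter> unit_disc = cball 0 r" using assms by auto
    then show ?thesis
      using emeasure_cball[of r "0 :: complex"] assms by (simp add: unit_ball_vol_2)
  qed
  moreover have "cball 0 r \<inter> unit_disc \<in> sets (lborel :: complex measure)"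
    by simp
  ultimately have e: "emeasure lebesgue (cball 0 r \<inter> unit_disc :: complex set) = ennreal (pi * r\<^sup>2)"
    by (simp add: emeasure_completion)
  have s: "cball 0 r \<inter> unit_disc \<in> sets (lebesgue_on unit_disc)"
    by (subst sets_restrict_space_iff) auto
  have "emeasure (lebesgue_on unit_disc) (cball 0 r \<inter> unit_disc) = ennreal (pi * r\<^sup>2)"
    using e by (subst emeasure_restrict_space) auto
  then show ?thesis
    unfolding dA_def using s
    by (subst emeasure_density_const) (auto simp flip: ennreal_mult)
qed

text \<open>This takes the place of polar coordinates. The disc of radius \<open>sqrt x\<close> has
  normalized area \<open>x\<close>, so both measures have the same distribution function, and radial
  integrals become integrals over the unit interval.\<close>

lemma distr_dA_norm_square: "distr dA borel (\<lambda>w. (cmod w)\<^sup>2) = uniform_measure lborel {0..1}"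
proof (rule cdf_unique)
  interpret P: prob_space dA
    by (rule prob_spaceI) (simp add: emeasure_dA_disc)
  interpret U: prob_space "uniform_measure lborel {0..1 :: real}"
    by (rule prob_space_uniform_measure) auto
  show 1: "real_distribution (distr dA borel (\<lambda>w. (cmod w)\<^sup>2))"
    by (rule P.real_distribution_distr) measurable
  show 2: "real_distribution (uniform_measure lborel {0..1})"
    by unfold_locales auto
  show "cdf (distr dA borel (\<lambda>w. (cmod w)\<^sup>2)) = cdf (uniform_measure lborel {0..1})"
  proof
    fix x :: real
    have vim: "(\<lambda>w. (cmod w)\<^sup>2) -` {..x} \<inter> space dA =
      (if x < 0 then {} else cball 0 (min 1 (sqrt x)) \<inter> unit_disc)"
    proof (cases "x < 0")
      case False
      then have "(cmod w)\<^sup>2 \<le> x \<longleftrightarrow> cmod w \<le> sqrt x" for w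
        using real_sqrt_le_iff[of "(cmod w)\<^sup>2" x] by simp
      then show ?thesis using False by auto
    qed (auto dest: order_trans[OF zero_le_power2])
    have "measure dA ((\<lambda>w. (cmod w)\<^sup>2) -` {..x} \<inter> space dA) = (if x < 0 then 0 else min 1 x)"
      using emeasure_dA_cball[of "min 1 (sqrt x)"] unfolding vim
      by (auto simp: measure_def min_def)
    moreover have "measure (uniform_measure lborel {0..1}) {..x} = (if x < 0 then 0 else min 1 x)"
    proof -
      have "{0..1} \<inter> {..x} = {0..min 1 x}" by auto
      then show ?thesis by (simp add: measure_uniform_measure)
    qed
    ultimately show "cdf (distr dA borel (\<lambda>w. (cmod w)\<^sup>2)) x = cdf (uniform_measure lborel {0..1}) x"
      by (simp add: cdf_def measure_distr)
  qed
qed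

lemma integral_dA_norm_power: "(\<integral>w. (cmod w) ^ (2 * n) \<partial>dA) = 1 / (real n + 1)"
proof -
  have "(\<integral>w. (cmod w) ^ (2 * n) \<partial>dA) = (\<integral>t. t ^ n \<partial>distr dA borel (\<lambda>w. (cmod w)\<^sup>2))"
    by (subst integral_distr) (auto simp: power_mult)
  also have "\<dots> = (\<integral>t. t ^ n * indicator {0..1} t \<partial>lborel)"
  proof -
    have "uniform_measure lborel {0..1 :: real} = density lborel (\<lambda>t. ennreal (indicator {0..1} t))"
      by (simp add: uniform_measure_def divide_ennreal_def ennreal_indicator)
    then show ?thesis
      unfolding distr_dA_norm_square by (simp add: integral_density mult.commute)
  qed
  also have "\<dots> = 1 / (real n + 1)"
    by (subst integral_power) (auto simp: add.commute)
  finally show ?thesis .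
qed

section \<open>Taylor coefficients as integrals against radial weights\<close>

text \<open>The angle \<open>x\<close> solves \<open>(j - n) * x = pi\<close>. Rotation by
  \<open>cis x\<close> therefore multiplies the integrand by -1 without changing the integral, which
  must be 0.\<close>

lemma integral_dA_monomial_eq_0:
  fixes h :: "real \<Rightarrow> real"
  assumes [measurable]: "h \<in> borel_measurable borel" and "j \<noteq> n"
  shows "(\<integral>w. w ^ j * cnj w ^ n * of_real (h (cmod w)) \<partial>dA) = 0"
proof -
  define f where "f = (\<lambda>w. w ^ j * cnj w ^ n * complex_of_real (h (cmod w)))"
  define x where "x = pi / (real j - real n)"
  define c where "c = cis x"
  have [measurable]: "f \<in> borel_measurable borel"
    unfolding f_def by measurable
  have "(real j - real n) * x = pi"
    using assms(2) by (simp add: x_def)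
  then have "real j * x - real n * x = pi"
    by (simp only: left_diff_distrib)
  then have c: "c ^ j * cnj c ^ n = -1"
    unfolding c_def cis_cnj Complex.DeMoivre cis_mult by simp
  have "integral\<^sup>L dA f = (\<integral>w. f (c * w) \<partial>dA)"
    by (rule integral_dA_rotation[symmetric]) (auto simp: c_def)
  also have "(\<lambda>w. f (c * w)) = (\<lambda>w. (c ^ j * cnj c ^ n) * f w)"
    by (auto simp: f_def power_mult_distrib norm_mult c_def)
  also have "integral\<^sup>L dA \<dots> = - integral\<^sup>L dA f"
    by (simp add: c)
  finally show ?thesis by (simp add: f_def)
qed

text \<open>
  Up to radius \<open>R < 1\<close> the power series may be integrated term by term; all terms but one vanish
  by rotation invariance. The restriction on the support of the weight \<open>h\<close> is removed afterwards
  by letting \<open>R\<close> tend to \<open>1\<close>.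
\<close>

lemma integral_dA_coeff_compact:
  fixes h :: "real \<Rightarrow> real"
  assumes sums: "\<And>w. cmod w < 1 \<Longrightarrow> (\<lambda>k. a k * w ^ k) sums f w"
    and [measurable]: "h \<in> borel_measurable borel"
    and int: "integrable dA (\<lambda>w. h (cmod w))"
    and R: "0 \<le> R" "R < 1" and hR: "\<And>t. R < t \<Longrightarrow> h t = 0"
  shows "(\<integral>w. f w * cnj w ^ n * of_real (h (cmod w)) \<partial>dA)
    = a n * of_real (\<integral>w. cmod w ^ (2 * n) * h (cmod w) \<partial>dA)"
proof -
  define g where "g = (\<lambda>k w. a k * (w ^ k * cnj w ^ n * complex_of_real (h (cmod w))))"
  have [measurable]: "g k \<in> borel_measurable dA" for k
    unfolding g_def by (rule borel_measurable_dA) measurable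
  have bound: "norm (g k w) \<le> norm (a k) * R ^ k * \<bar>h (cmod w)\<bar>" if "cmod w < 1" for k w
  proof (cases "cmod w \<le> R")
    case True
    have "cmod w ^ k * cmod w ^ n \<le> R ^ k * 1"
      using True R by (intro mult_mono power_mono power_le_one) auto
    then have "norm (a k) * (cmod w ^ k * cmod w ^ n) * \<bar>h (cmod w)\<bar> \<le> norm (a k) * R ^ k * \<bar>h (cmod w)\<bar>"
      by (intro mult_right_mono mult_left_mono) auto
    then show ?thesis
      by (simp add: g_def norm_mult norm_power mult_ac)
  qed (use hR in \<open>auto simp: g_def\<close>)
  have summ: "summable (\<lambda>k. norm (a k) * R ^ k)"
  proof -
    \<comment> \<open>The midpoint of \<open>R\<close> and 1 still lies in the disc; convergence
      there gives absolute convergence at the smaller radius \<open>R\<close>.\<close>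
    have "summable (\<lambda>k. a k * of_real ((R + 1) / 2) ^ k)"
      using sums[of "of_real ((R + 1) / 2)"] R by (auto intro: sums_summable simp del: of_real_add of_real_divide)
    then have "summable (\<lambda>k. norm (a k * of_real R ^ k))"
      by (rule powser_insidea) (use R in \<open>auto simp del: of_real_add of_real_divide\<close>)
    then show ?thesis
      using R by (simp add: norm_mult norm_power)
  qed
  have intg: "integrable dA (g k)" for k
  proof (rule Bochner_Integration.integrable_bound)
    show "integrable dA (\<lambda>w. norm (a k) * R ^ k * \<bar>h (cmod w)\<bar>)"
      using int by simp
    show "AE w in dA. norm (g k w) \<le> norm (norm (a k) * R ^ k * \<bar>h (cmod w)\<bar>)"
      by (rule AE_I2) (use bound R in \<open>auto simp: abs_mult\<close>)
  qed simp
  have "(\<lambda>k. integral\<^sup>L dA (g k)) sums (\<integral>w. (\<Sum>k. g k w) \<partial>dA)"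
  proof (rule sums_integral[OF intg])
    show "AE w in dA. summable (\<lambda>k. norm (g k w))"
    proof (rule AE_I2)
      fix w assume "w \<in> space dA"
      then show "summable (\<lambda>k. norm (g k w))"
        by (intro summable_comparison_test'[OF summable_mult2[OF summ, of "\<bar>h (cmod w)\<bar>"]])
          (use bound in auto)
    qed
    show "summable (\<lambda>k. \<integral>w. norm (g k w) \<partial>dA)"
    proof (rule summable_comparison_test'[OF summable_mult2[OF summ, of "\<integral>w. \<bar>h (cmod w)\<bar> \<partial>dA"]])
      fix k
      have "(\<integral>w. norm (g k w) \<partial>dA) \<le> (\<integral>w. norm (a k) * R ^ k * \<bar>h (cmod w)\<bar> \<partial>dA)"
        using int intg bound by (intro integral_mono) auto
      then show "norm (\<integral>w. norm (g k w) \<partial>dA) \<le> norm (a k) * R ^ k * (\<integral>w. \<bar>h (cmod w)\<bar> \<partial>dA)"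
        by simp
    qed
  qed
  also have "(\<integral>w. (\<Sum>k. g k w) \<partial>dA) = (\<integral>w. f w * cnj w ^ n * of_real (h (cmod w)) \<partial>dA)"
  proof (rule Bochner_Integration.integral_cong)
    fix w assume "w \<in> space dA"
    then have "(\<lambda>k. a k * w ^ k * (cnj w ^ n * of_real (h (cmod w)))) sums (f w * (cnj w ^ n * of_real (h (cmod w))))"
      by (intro sums_mult2 sums) auto
    then show "(\<Sum>k. g k w) = f w * cnj w ^ n * of_real (h (cmod w))"
      by (simp add: g_def sums_iff mult.assoc)
  qed simp
  finally have 1: "(\<lambda>k. integral\<^sup>L dA (g k)) sums (\<integral>w. f w * cnj w ^ n * of_real (h (cmod w)) \<partial>dA)" .
  have "integral\<^sup>L dA (g k) = 0" if "k \<noteq> n" for k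
    using integral_dA_monomial_eq_0[OF assms(2) that] by (simp add: g_def)
  then have "(\<lambda>k. integral\<^sup>L dA (g k)) sums integral\<^sup>L dA (g n)"
    using sums_finite[of "{n}" "\<lambda>k. integral\<^sup>L dA (g k)"] by simp
  moreover have "integral\<^sup>L dA (g n) = a n * of_real (\<integral>w. cmod w ^ (2 * n) * h (cmod w) \<partial>dA)"
  proof -
    have "complex_of_real (cmod w ^ (2 * n)) = w ^ n * cnj w ^ n" for w
      by (metis complex_norm_square of_real_power power_mult power_mult_distrib)
    then have "w ^ n * cnj w ^ n * complex_of_real (h (cmod w)) = of_real (cmod w ^ (2 * n) * h (cmod w))" for w
      by simp
    then show ?thesis
      by (simp only: g_def) (simp flip: of_real_mult of_real_power)
  qed
  ultimately show ?thesis
    using 1 sums_unique2 by force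
qed

lemma integral_dA_coeff:
  fixes h :: "real \<Rightarrow> real"
  assumes sums: "\<And>w. cmod w < 1 \<Longrightarrow> (\<lambda>k. a k * w ^ k) sums f w"
    and h [measurable]: "h \<in> borel_measurable borel"
    and int: "integrable dA (\<lambda>w. h (cmod w))"
    and intf: "integrable dA (\<lambda>w. f w * of_real (h (cmod w)))"
  shows "(\<integral>w. f w * cnj w ^ n * of_real (h (cmod w)) \<partial>dA)
    = a n * of_real (\<integral>w. cmod w ^ (2 * n) * h (cmod w) \<partial>dA)"
proof -
  have mf [measurable]: "(\<lambda>w. f w * of_real (h (cmod w))) \<in> borel_measurable dA"
    using intf by (rule borel_measurable_integrable)
  define R where "R = (\<lambda>m. 1 - 1 / real (Suc m))"
  have R: "0 \<le> R m" "R m < 1" for m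
    by (auto simp: R_def)
  have "R \<longlonglongrightarrow> 1 - 0"
    unfolding R_def by (intro tendsto_intros LIMSEQ_Suc lim_1_over_n)
  then have Rlim: "R \<longlonglongrightarrow> 1" by simp
  \<comment> \<open>Every point of the disc eventually lies within radius \<open>R m\<close>, so the
    truncated weights agree with \<open>h\<close> there from some index on, and the untruncated
    integrands dominate.\<close>
  define H where "H = (\<lambda>m t. indicator {..R m} t * h t)"
  have ev: "\<forall>\<^sub>F m in sequentially. H m (cmod w) = h (cmod w)" if "w \<in> space dA" for w
  proof -
    have "\<forall>\<^sub>F m in sequentially. cmod w < R m"
      using that by (intro order_tendstoD(1)[OF Rlim]) auto
    then show ?thesis
      by eventually_elim (auto simp: H_def)
  qed
  have Hle: "\<bar>H m t\<bar> \<le> \<bar>h t\<bar>" for m t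
    by (auto simp: H_def indicator_def)
  have [measurable]: "H m \<in> borel_measurable borel" for m
    unfolding H_def by measurable
  have mh [measurable]: "(\<lambda>w. h (cmod w)) \<in> borel_measurable dA"
    by (rule borel_measurable_dA) measurable
  have mH [measurable]: "(\<lambda>w. H m (cmod w)) \<in> borel_measurable dA" for m
    by (rule borel_measurable_dA) measurable
  have mc [measurable]: "cnj \<in> borel_measurable dA" "(\<lambda>w. cmod w) \<in> borel_measurable dA"
    by (rule borel_measurable_dA, measurable)+
  have mi [measurable]: "(\<lambda>w. indicator {..R m} (cmod w) :: complex) \<in> borel_measurable dA" for m
    by (rule borel_measurable_dA) measurable
  have intH: "integrable dA (\<lambda>w. H m (cmod w))" for m
    by (rule Bochner_Integration.integrable_bound[OF int]) (use Hle in auto)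
  have eq: "(\<integral>w. f w * cnj w ^ n * of_real (H m (cmod w)) \<partial>dA)
    = a n * of_real (\<integral>w. cmod w ^ (2 * n) * H m (cmod w) \<partial>dA)" for m
    by (rule integral_dA_coeff_compact[OF sums _ intH R[of m]]) (auto simp: H_def)
  have pow: "cmod w ^ k \<le> 1" if "w \<in> space dA" for w k
    using that by (intro power_le_one) auto
  have "(\<lambda>m. \<integral>w. f w * cnj w ^ n * of_real (H m (cmod w)) \<partial>dA) \<longlonglongrightarrow>
    (\<integral>w. f w * cnj w ^ n * of_real (h (cmod w)) \<partial>dA)"
  proof (rule integral_dominated_convergence)
    \<comment> \<open>The integrability assumption gives measurability of the product of
      \<open>f\<close> with the weight only, so the integrands are rewritten as multiples of that
      product.\<close>
    have *: "(\<lambda>w. f w * cnj w ^ n * of_real (h (cmod w))) = (\<lambda>w. (f w * of_real (h (cmod w))) * cnj w ^ n)"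
      by (simp add: mult_ac)
    show "(\<lambda>w. f w * cnj w ^ n * of_real (h (cmod w))) \<in> borel_measurable dA"
      unfolding * by measurable
    have *: "(\<lambda>w. f w * cnj w ^ n * of_real (H m (cmod w)))
      = (\<lambda>w. (f w * of_real (h (cmod w))) * cnj w ^ n * indicator {..R m} (cmod w))" for m
      by (auto simp: H_def indicator_def)
    show "(\<lambda>w. f w * cnj w ^ n * of_real (H m (cmod w))) \<in> borel_measurable dA" for m
      unfolding * by measurable
    show "integrable dA (\<lambda>w. norm (f w * of_real (h (cmod w))))"
      using intf by (rule integrable_norm)
    show "AE w in dA. (\<lambda>m. f w * cnj w ^ n * of_real (H m (cmod w))) \<longlonglongrightarrow> f w * cnj w ^ n * of_real (h (cmod w))"
      by (rule AE_I2, rule tendsto_eventually) (use ev in \<open>auto elim: eventually_mono\<close>)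
    show "AE w in dA. norm (f w * cnj w ^ n * of_real (H m (cmod w))) \<le> norm (f w * of_real (h (cmod w)))" for m
    proof (rule AE_I2)
      fix w assume "w \<in> space dA"
      then have "norm (f w) * (cmod w ^ n * \<bar>H m (cmod w)\<bar>) \<le> norm (f w) * (1 * \<bar>h (cmod w)\<bar>)"
        using pow Hle by (intro mult_left_mono mult_mono) auto
      then show "norm (f w * cnj w ^ n * of_real (H m (cmod w))) \<le> norm (f w * of_real (h (cmod w)))"
        by (simp add: norm_mult norm_power mult.assoc)
    qed
  qed
  moreover have "(\<lambda>m. \<integral>w. cmod w ^ (2 * n) * H m (cmod w) \<partial>dA) \<longlonglongrightarrow> (\<integral>w. cmod w ^ (2 * n) * h (cmod w) \<partial>dA)"
  proof (rule integral_dominated_convergence)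
    show "integrable dA (\<lambda>w. \<bar>h (cmod w)\<bar>)"
      using int by simp
    show "AE w in dA. (\<lambda>m. cmod w ^ (2 * n) * H m (cmod w)) \<longlonglongrightarrow> cmod w ^ (2 * n) * h (cmod w)"
      by (rule AE_I2, rule tendsto_eventually) (use ev in \<open>auto elim: eventually_mono\<close>)
    show "AE w in dA. norm (cmod w ^ (2 * n) * H m (cmod w)) \<le> \<bar>h (cmod w)\<bar>" for m
    proof (rule AE_I2)
      fix w assume "w \<in> space dA"
      then have "cmod w ^ (2 * n) * \<bar>H m (cmod w)\<bar> \<le> 1 * \<bar>h (cmod w)\<bar>"
        using pow Hle by (intro mult_mono) auto
      then show "norm (cmod w ^ (2 * n) * H m (cmod w)) \<le> \<bar>h (cmod w)\<bar>"
        by (simp add: abs_mult)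
    qed
  qed measurable
  then have "(\<lambda>m. a n * of_real (\<integral>w. cmod w ^ (2 * n) * H m (cmod w) \<partial>dA))
    \<longlonglongrightarrow> a n * of_real (\<integral>w. cmod w ^ (2 * n) * h (cmod w) \<partial>dA)"
    by (intro tendsto_intros)
  ultimately show ?thesis
    unfolding eq by (rule LIMSEQ_unique)
qed

text \<open>Induction on \<open>k\<close>: the Cauchy product with the geometric series raises the
  exponent by one, and the hockey-stick identity sums the binomial coefficients.\<close>

lemma binomial_series_complex:
  fixes x :: complex
  assumes "cmod x < 1"
  shows "(\<lambda>n. of_nat (n + k choose k) * x ^ n) sums (1 / (1 - x) ^ Suc k)"
  using assms
proof (induction k arbitrary: x)
  case 0
  then show ?case using geometric_sums[of x] by simp
next
  case (Suc k)
  \<comment> \<open>A point of modulus strictly between \<open>cmod x\<close> and 1: convergence at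
    \<open>y\<close>, from the induction hypothesis, gives absolute convergence at \<open>x\<close>,
    as the Cauchy product requires.\<close>
  define y where "y = complex_of_real ((cmod x + 1) / 2)"
  have y: "cmod y = (cmod x + 1) / 2"
    unfolding y_def norm_of_real by simp
  have "summable (\<lambda>n. of_nat (n + k choose k) * y ^ n)"
    using Suc.IH[of y] Suc.prems y by (auto intro: sums_summable)
  then have "summable (\<lambda>n. norm (of_nat (n + k choose k) * x ^ n))"
    by (rule powser_insidea) (use Suc.prems y in auto)
  moreover have "summable (\<lambda>n. norm (x ^ n))"
    using Suc.prems by (simp add: norm_power)
  ultimately have "(\<lambda>n. \<Sum>i\<le>n. of_nat (i + k choose k) * x ^ i * x ^ (n - i)) sums
    ((\<Sum>n. of_nat (n + k choose k) * x ^ n) * (\<Sum>n. x ^ n))"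
    by (rule Cauchy_product_sums)
  moreover have "(\<Sum>n. of_nat (n + k choose k) * x ^ n) = 1 / (1 - x) ^ Suc k"
    using Suc.IH[OF Suc.prems] by (rule sums_unique[symmetric])
  moreover have "(\<Sum>n. x ^ n) = 1 / (1 - x)"
    using Suc.prems by (rule suminf_geometric)
  moreover have "(\<Sum>i\<le>n. of_nat (i + k choose k) * x ^ i * x ^ (n - i)) = of_nat (n + Suc k choose Suc k) * x ^ n" for n
  proof -
    have "(\<Sum>i\<le>n. i + k choose k) = (n + Suc k choose Suc k)"
      by (induction n) auto
    then have "of_nat (n + Suc k choose Suc k) * x ^ n = (\<Sum>i\<le>n. of_nat (i + k choose k) * x ^ n)"
      by (metis of_nat_sum sum_distrib_right)
    also have "\<dots> = (\<Sum>i\<le>n. of_nat (i + k choose k) * x ^ i * x ^ (n - i))"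
      by (intro sum.cong) (auto simp: mult.assoc simp flip: power_add)
    finally show ?thesis ..
  qed
  ultimately show ?case
    by (simp add: mult.commute)
qed

section \<open>Kernels and the reproducing formula\<close>

lemma kernel_denominator_ge:
  assumes "cmod w < 1" "cmod z \<le> 1"
  shows "1 - cmod w \<le> cmod (1 - w * cnj z)"
proof -
  have "cmod (w * cnj z) \<le> cmod w * 1"
    unfolding norm_mult using assms by (intro mult_left_mono) auto
  then show ?thesis
    using norm_triangle_ineq2[of 1 "w * cnj z"] by simp
qed

lemma kernel_bound:
  assumes "cmod w < 1" "cmod z \<le> 1"
  shows "cmod (1 / (1 - w * cnj z) ^ k) \<le> 1 / (1 - cmod w) ^ k"
proof -
  have "0 < cmod (1 - w * cnj z)"
    using kernel_denominator_ge[OF assms] assms(1) by linarith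
  then show ?thesis
    using kernel_denominator_ge[OF assms] assms(1) unfolding norm_divide norm_power norm_one
    by (intro divide_left_mono power_mono mult_pos_pos zero_less_power) auto
qed

lemma integrable_dA_kernel:
  assumes "integrable dA F" "cmod w < 1"
  shows "integrable dA (\<lambda>z. F z / (1 - w * cnj z) ^ k)"
proof (rule Bochner_Integration.integrable_bound)
  have [measurable]: "F \<in> borel_measurable dA" "cnj \<in> borel_measurable dA"
    using assms(1) by (auto intro: borel_measurable_integrable borel_measurable_dA)
  show "(\<lambda>z. F z / (1 - w * cnj z) ^ k) \<in> borel_measurable dA"
    by measurable
  show "integrable dA (\<lambda>z. norm (F z) * (1 / (1 - cmod w) ^ k))"
    using assms(1) by simp
  show "AE z in dA. norm (F z / (1 - w * cnj z) ^ k) \<le> norm (norm (F z) * (1 / (1 - cmod w) ^ k))"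
  proof (rule AE_I2)
    fix z assume "z \<in> space dA"
    then have "norm (F z) * cmod (1 / (1 - w * cnj z) ^ k) \<le> norm (F z) * (1 / (1 - cmod w) ^ k)"
      using assms by (intro mult_left_mono kernel_bound) auto
    then show "norm (F z / (1 - w * cnj z) ^ k) \<le> norm (norm (F z) * (1 / (1 - cmod w) ^ k))"
      using assms(2) by (simp add: norm_divide norm_power)
  qed
qed

section \<open>Kernel integrals as power series\<close>

text \<open>The kernel is expanded in its binomial series and integrated term by term, which reduces
  kernel integrals to the moments of \<open>F\<close> against powers of \<open>cnj z\<close>. Since
  \<open>|z| < 1\<close>, these are bounded by the integral of \<open>norm (F z)\<close>, while the
  remaining factors are absolutely summable.\<close>

lemma integral_dA_kernel_sums:
  assumes int: "integrable dA F" and w: "cmod w < 1"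
  shows "(\<lambda>n. of_nat (n + k choose k) * (\<integral>z. F z * cnj z ^ n \<partial>dA) * w ^ n)
    sums (\<integral>z. F z / (1 - w * cnj z) ^ Suc k \<partial>dA)"
proof -
  have [measurable]: "F \<in> borel_measurable dA" "cnj \<in> borel_measurable dA"
    using assms(1) by (auto intro: borel_measurable_integrable borel_measurable_dA)
  define g where "g = (\<lambda>n z. of_nat (n + k choose k) * w ^ n * (F z * cnj z ^ n))"
  have bound: "norm (g n z) \<le> norm (of_nat (n + k choose k) * w ^ n) * norm (F z)" if "cmod z < 1" for n z
  proof -
    have "norm (F z) * cmod z ^ n \<le> norm (F z) * 1"
      using that by (intro mult_left_mono power_le_one) auto
    then show ?thesis
      unfolding g_def norm_mult[of "_ * _" "_ * _"] by (intro mult_left_mono) (auto simp: norm_mult norm_power)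
  qed
  define y where "y = complex_of_real ((cmod w + 1) / 2)"
  have y: "cmod y = (cmod w + 1) / 2"
    unfolding y_def norm_of_real by simp
  have summ: "summable (\<lambda>n. norm (of_nat (n + k choose k) * w ^ n))"
  proof (rule powser_insidea)
    show "summable (\<lambda>n. of_nat (n + k choose k) * y ^ n)"
      using binomial_series_complex[of y k] w y by (auto intro: sums_summable)
  qed (use w y in auto)
  have intg: "integrable dA (g n)" for n
  proof (rule Bochner_Integration.integrable_bound)
    show "integrable dA (\<lambda>z. norm (of_nat (n + k choose k) * w ^ n) * norm (F z))"
      using int by simp
    show "g n \<in> borel_measurable dA"
      unfolding g_def by measurable
    show "AE z in dA. norm (g n z) \<le> norm (norm (of_nat (n + k choose k) * w ^ n) * norm (F z))"
      by (rule AE_I2) (use bound[of _ n] in \<open>simp add: abs_mult\<close>)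
  qed
  have "(\<lambda>n. integral\<^sup>L dA (g n)) sums (\<integral>z. (\<Sum>n. g n z) \<partial>dA)"
  proof (rule sums_integral[OF intg])
    show "AE z in dA. summable (\<lambda>n. norm (g n z))"
    proof (rule AE_I2)
      fix z assume "z \<in> space dA"
      then show "summable (\<lambda>n. norm (g n z))"
        by (intro summable_comparison_test'[OF summable_mult2[OF summ, of "norm (F z)"]])
          (use bound in auto)
    qed
    show "summable (\<lambda>n. \<integral>z. norm (g n z) \<partial>dA)"
    proof (rule summable_comparison_test'[OF summable_mult2[OF summ, of "\<integral>z. norm (F z) \<partial>dA"]])
      fix n
      have "(\<integral>z. norm (g n z) \<partial>dA) \<le> (\<integral>z. norm (of_nat (n + k choose k) * w ^ n) * norm (F z) \<partial>dA)"
        using int intg bound by (intro integral_mono) auto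
      then show "norm (\<integral>z. norm (g n z) \<partial>dA) \<le> norm (of_nat (n + k choose k) * w ^ n) * (\<integral>z. norm (F z) \<partial>dA)"
        by simp
    qed
  qed
  also have "(\<integral>z. (\<Sum>n. g n z) \<partial>dA) = (\<integral>z. F z / (1 - w * cnj z) ^ Suc k \<partial>dA)"
  proof (rule Bochner_Integration.integral_cong)
    fix z assume "z \<in> space dA"
    then have "cmod (w * cnj z) < 1"
      using w mult_strict_mono'[of "cmod w" 1 "cmod z" 1] by (simp add: norm_mult)
    then have "(\<lambda>n. F z * (of_nat (n + k choose k) * (w * cnj z) ^ n)) sums (F z * (1 / (1 - w * cnj z) ^ Suc k))"
      by (intro sums_mult binomial_series_complex)
    then show "(\<Sum>n. g n z) = F z / (1 - w * cnj z) ^ Suc k"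
      by (simp add: g_def sums_iff power_mult_distrib mult_ac)
  qed simp
  also have "(\<lambda>n. integral\<^sup>L dA (g n)) = (\<lambda>n. of_nat (n + k choose k) * (\<integral>z. F z * cnj z ^ n \<partial>dA) * w ^ n)"
    unfolding g_def integral_mult_right_zero by (simp only: mult_ac)
  finally show ?thesis .
qed

text \<open>The integrand is the holomorphic function \<open>f\<close> times its conjugate. The
  Taylor coefficient \<open>(n + 1) * cnj w ^ n\<close> of \<open>f\<close> meets the radial moment
  \<open>1 / (n + 1)\<close>, so the moments of \<open>f\<close> are \<open>cnj w ^ n\<close>, and
  the kernel expansion becomes the binomial series in \<open>|w|^2\<close>.\<close>

lemma integral_dA_kernel_norm:
  assumes w: "cmod w < 1"
  shows "(\<integral>z. 1 / cmod (1 - w * cnj z) ^ 4 \<partial>dA) = 1 / (1 - (cmod w)\<^sup>2)\<^sup>2"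
proof -
  define f where "f = (\<lambda>z. 1 / (1 - cnj w * z)\<^sup>2)"
  define a where "a = (\<lambda>n. of_nat (Suc n) * cnj w ^ n)"
  have f_sums: "(\<lambda>n. a n * z ^ n) sums f z" if "cmod z < 1" for z
  proof -
    have "cmod (cnj w * z) < 1"
      using w that mult_strict_mono'[of "cmod w" 1 "cmod z" 1] by (simp add: norm_mult)
    from binomial_series_complex[OF this, of 1] show ?thesis
      by (simp add: a_def f_def power_mult_distrib mult_ac power2_eq_square del: of_nat_Suc)
  qed
  have f_cnj: "f = (\<lambda>z. cnj (1 / (1 - w * cnj z)\<^sup>2))"
    by (simp add: f_def)
  have intf: "integrable dA f"
    unfolding f_cnj complex_integrable_cnj by (rule integrable_dA_kernel[OF _ w]) simp
  have coeff: "(\<integral>z. f z * cnj z ^ n \<partial>dA) = cnj w ^ n" for n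
  proof -
    have "(\<integral>z. f z * cnj z ^ n * of_real 1 \<partial>dA) = a n * of_real (\<integral>z. cmod z ^ (2 * n) * 1 \<partial>dA)"
      by (rule integral_dA_coeff[of a f "\<lambda>_. 1" n]) (use f_sums intf in auto)
    moreover have "complex_of_real (1 / (real n + 1)) = 1 / of_nat (Suc n)"
      by simp
    ultimately show ?thesis
      by (simp add: integral_dA_norm_power a_def del: of_nat_Suc)
  qed
  have "(\<lambda>n. of_nat (n + 1 choose 1) * (\<integral>z. f z * cnj z ^ n \<partial>dA) * w ^ n)
    sums (\<integral>z. f z / (1 - w * cnj z) ^ Suc 1 \<partial>dA)"
    by (rule integral_dA_kernel_sums[OF intf w])
  also have "(\<lambda>n. of_nat (n + 1 choose 1) * (\<integral>z. f z * cnj z ^ n \<partial>dA) * w ^ n)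
    = (\<lambda>n. of_nat (n + 1 choose 1) * (of_real ((cmod w)\<^sup>2)) ^ n)"
    unfolding coeff complex_norm_square by (simp add: power_mult_distrib mult_ac)
  also have "(\<integral>z. f z / (1 - w * cnj z) ^ Suc 1 \<partial>dA) = (\<integral>z. of_real (1 / cmod (1 - w * cnj z) ^ 4) \<partial>dA)"
  proof (intro Bochner_Integration.integral_cong refl)
    fix z
    have "complex_of_real (cmod (1 - w * cnj z) ^ 4) = (of_real ((cmod (1 - w * cnj z))\<^sup>2))\<^sup>2"
      by (simp flip: power_mult)
    also have "\<dots> = (1 - w * cnj z)\<^sup>2 * (1 - cnj w * z)\<^sup>2"
      unfolding complex_norm_square by (simp add: power_mult_distrib)
    finally show "f z / (1 - w * cnj z) ^ Suc 1 = of_real (1 / cmod (1 - w * cnj z) ^ 4)"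
      by (simp add: f_def power2_eq_square mult_ac)
  qed
  finally have "(\<lambda>n. of_nat (n + 1 choose 1) * complex_of_real ((cmod w)\<^sup>2) ^ n)
    sums of_real (\<integral>z. 1 / cmod (1 - w * cnj z) ^ 4 \<partial>dA)"
    by (simp only: integral_complex_of_real)
  moreover have "(\<lambda>n. of_nat (n + 1 choose 1) * complex_of_real ((cmod w)\<^sup>2) ^ n)
    sums (1 / (1 - of_real ((cmod w)\<^sup>2)) ^ Suc 1)"
    using w by (intro binomial_series_complex) (simp add: norm_power power_less_one_iff abs_square_less_1)
  ultimately have "complex_of_real (\<integral>z. 1 / cmod (1 - w * cnj z) ^ 4 \<partial>dA) = of_real (1 / (1 - (cmod w)\<^sup>2)\<^sup>2)"
    using sums_unique2 by (fastforce simp: power2_eq_square)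
  then show ?thesis
    by (simp only: of_real_eq_iff)
qed

text \<open>This is the mean value property: only the constant term of the conjugate holomorphic
  kernel survives integration. It governs the action of the operator on constants.\<close>

lemma integral_dA_kernel_one:
  assumes w: "cmod w < 1"
  shows "(\<integral>z. 1 / (1 - w * cnj z) ^ Suc k \<partial>dA) = 1"
proof -
  have m: "(\<integral>z. 1 * cnj z ^ n \<partial>dA) = (if n = 0 then 1 else 0)" for n
    using integral_dA_monomial_eq_0[of "\<lambda>_. 1" 0 n] integral_dA_norm_power[of 0] by auto
  have "(\<lambda>n. of_nat (n + k choose k) * (\<integral>z. 1 * cnj z ^ n \<partial>dA) * w ^ n)
    sums (\<integral>z. 1 / (1 - w * cnj z) ^ Suc k \<partial>dA)"
    by (rule integral_dA_kernel_sums[OF _ w]) auto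
  moreover have "(\<lambda>n. of_nat (n + k choose k) * (\<integral>z. 1 * cnj z ^ n \<partial>dA) * w ^ n) sums 1"
    unfolding m using sums_finite[of "{0}" "\<lambda>n. of_nat (n + k choose k) * (if n = 0 then 1 else 0) * w ^ n"] by simp
  ultimately show ?thesis
    by (rule sums_unique2)
qed

section \<open>The weighted reproducing formula\<close>

lemma choose_three: "6 * (n + 3 choose 3) = (n + 1) * (n + 2) * (n + 3)"
proof -
  have "(n + 3) * (n + 2 choose 2) = (n + 3 choose 3) * 3" "(n + 2) * (n + 1 choose 1) = (n + 2 choose 2) * 2"
    using Suc_times_binomial_eq[of "n + 2" 2] Suc_times_binomial_eq[of "n + 1" 1]
    by (simp_all add: eval_nat_numeral)
  then have "(n + 3) * ((n + 2) * (n + 1)) = (n + 3) * ((n + 2 choose 2) * 2)"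
    "(n + 3) * (n + 2 choose 2) = (n + 3 choose 3) * 3"
    by auto
  then show ?thesis by (simp add: algebra_simps)
qed

text \<open>Expanding the square leaves three radial moments. The result times
  \<open>n + 3 choose 3\<close>, the coefficient of the fourth-power kernel, is 1/3 for every
  \<open>n\<close>; this is why the weight exponent 2 goes with the kernel exponent 4 and the
  constant 3.\<close>

lemma integral_dA_weight_power:
  "(\<integral>w. cmod w ^ (2 * n) * (1 - (cmod w)\<^sup>2)\<^sup>2 \<partial>dA) = 2 / ((real n + 1) * (real n + 2) * (real n + 3))"
proof -
  have int: "integrable dA (\<lambda>w. cmod w ^ k)" for k
    by (rule dA.integrable_const_bound[where B=1]) (auto intro!: AE_I2 power_le_one)
  have "(\<integral>w. cmod w ^ (2 * n) * (1 - (cmod w)\<^sup>2)\<^sup>2 \<partial>dA)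
    = (\<integral>w. cmod w ^ (2 * n) - 2 * cmod w ^ (2 * Suc n) + cmod w ^ (2 * Suc (Suc n)) \<partial>dA)"
    by (intro Bochner_Integration.integral_cong) (auto simp: power2_eq_square algebra_simps)
  also have "\<dots> = 1 / (real n + 1) - 2 * (1 / (real n + 2)) + 1 / (real n + 3)"
    using int integral_dA_norm_power[of n] integral_dA_norm_power[of "Suc n"] integral_dA_norm_power[of "Suc (Suc n)"]
    by (simp add: add.commute del: mult_Suc_right)
  also have "\<dots> = 2 / ((real n + 1) * (real n + 2) * (real n + 3))"
    by (simp add: divide_simps) (simp add: algebra_simps)
  finally show ?thesis .
qed

text \<open>Each Taylor coefficient is multiplied by a moment of the weight and by a binomial
  coefficient, whose product is 1/3. Integrability is asked only after weighting, because the
  formula is also applied to \<open>1 / (1 - z)^2\<close>, which is not integrable over the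
  disc.\<close>

lemma weighted_reproducing:
  assumes hol: "f holomorphic_on unit_disc"
    and int: "integrable dA (\<lambda>w. f w * of_real ((1 - (cmod w)\<^sup>2)\<^sup>2))"
    and z: "cmod z < 1"
  shows "3 * (\<integral>w. f w * of_real ((1 - (cmod w)\<^sup>2)\<^sup>2) / (1 - z * cnj w) ^ 4 \<partial>dA) = f z"
proof -
  define a where "a = (\<lambda>n. (deriv ^^ n) f 0 / fact n)"
  have sums: "(\<lambda>n. a n * w ^ n) sums f w" if "cmod w < 1" for w
    using holomorphic_power_series[OF hol, of w] that by (simp add: a_def)
  have coeff: "(\<integral>w. f w * of_real ((1 - (cmod w)\<^sup>2)\<^sup>2) * cnj w ^ n \<partial>dA)
    = a n * of_real (2 / ((real n + 1) * (real n + 2) * (real n + 3)))" for n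
  proof -
    have "(\<integral>w. f w * cnj w ^ n * of_real ((1 - (cmod w)\<^sup>2)\<^sup>2) \<partial>dA)
      = a n * of_real (\<integral>w. cmod w ^ (2 * n) * (1 - (cmod w)\<^sup>2)\<^sup>2 \<partial>dA)"
    proof (rule integral_dA_coeff[OF sums, where h = "\<lambda>t. (1 - t\<^sup>2)\<^sup>2"])
      show "integrable dA (\<lambda>w. (1 - (cmod w)\<^sup>2)\<^sup>2)"
        by (rule dA.integrable_const_bound[where B=1])
          (auto intro!: AE_I2 power_le_one simp: abs_square_le_1)
    qed (use int in auto)
    then show ?thesis
      unfolding integral_dA_weight_power by (simp only: mult_ac)
  qed
  have "(\<lambda>n. of_nat (n + 3 choose 3) * (\<integral>w. f w * of_real ((1 - (cmod w)\<^sup>2)\<^sup>2) * cnj w ^ n \<partial>dA) * z ^ n)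
    sums (\<integral>w. f w * of_real ((1 - (cmod w)\<^sup>2)\<^sup>2) / (1 - z * cnj w) ^ Suc 3 \<partial>dA)"
    by (rule integral_dA_kernel_sums[OF int z])
  also have "(\<lambda>n. of_nat (n + 3 choose 3) * (\<integral>w. f w * of_real ((1 - (cmod w)\<^sup>2)\<^sup>2) * cnj w ^ n \<partial>dA) * z ^ n)
    = (\<lambda>n. a n * z ^ n / 3)"
  proof
    fix n
    have "6 * real (n + 3 choose 3) = (real n + 1) * (real n + 2) * (real n + 3)"
      using arg_cong[OF choose_three[of n], of real] by (simp add: algebra_simps)
    then have "real (n + 3 choose 3) * (2 / ((real n + 1) * (real n + 2) * (real n + 3))) = 1 / 3"
      by (simp add: divide_simps)
    then have "complex_of_real (real (n + 3 choose 3)) * of_real (2 / ((real n + 1) * (real n + 2) * (real n + 3))) = of_real (1 / 3)"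
      by (simp only: of_real_mult[symmetric])
    from arg_cong[OF this, of "\<lambda>c. c * (a n * z ^ n)"]
    have "(complex_of_real (real (n + 3 choose 3)) * of_real (2 / ((real n + 1) * (real n + 2) * (real n + 3)))) * (a n * z ^ n) = a n * z ^ n / 3"
      by (simp only: of_real_divide of_real_1 of_real_numeral) simp
    then show "of_nat (n + 3 choose 3) * (\<integral>w. f w * of_real ((1 - (cmod w)\<^sup>2)\<^sup>2) * cnj w ^ n \<partial>dA) * z ^ n = a n * z ^ n / 3"
      unfolding coeff by (simp only: mult_ac of_real_of_nat_eq)
  qed
  finally have "(\<lambda>n. a n * z ^ n / 3) sums (\<integral>w. f w * of_real ((1 - (cmod w)\<^sup>2)\<^sup>2) / (1 - z * cnj w) ^ 4 \<partial>dA)"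
    by simp
  from sums_unique2[OF sums_mult[OF this, of 3]] sums[OF z] show ?thesis
    by simp
qed

section \<open>A bounded operator with kernel \<open>(A\<^sup>1)\<^sup>\<bottom>\<close>\<close>

text \<open>This is the adjoint of the weighted Bergman projection given by the integral in
  \<open>weighted_reproducing\<close>. On the unit circle the factor in front is 0, so the formula
  has the value 0 there whatever the integral is.\<close>

definition bergman_op :: "(complex \<Rightarrow> complex) \<Rightarrow> complex \<Rightarrow> complex"
  where "bergman_op \<phi> w =
    3 * of_real ((1 - (cmod w)\<^sup>2)\<^sup>2) * (\<integral>z. \<phi> z / (1 - w * cnj z) ^ 4 \<partial>dA)"

lemma ess_bounded_integrable: "ess_bounded \<phi> \<Longrightarrow> integrable dA \<phi>"
  using ess_norm_AE[of \<phi>] by (intro dA.integrable_const_bound) (auto simp: ess_bounded_measurable)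

lemma integrable_dA_kernel_norm:
  assumes "cmod w < 1"
  shows "integrable dA (\<lambda>z. 1 / cmod (1 - w * cnj z) ^ k)"
  using integrable_norm[OF integrable_dA_kernel[of "\<lambda>_. 1" w k]] assms
  by (simp add: norm_divide norm_power)

lemma integral_norm_bound_AE:
  fixes f :: "_ \<Rightarrow> _ :: {banach, second_countable_topology}"
  assumes "integrable M f" "integrable M g" "AE x in M. norm (f x) \<le> g x"
  shows "norm (integral\<^sup>L M f) \<le> integral\<^sup>L M g"
  by (rule order_trans[OF integral_norm_bound integral_mono_AE]) (use assms in auto)

text \<open>The factor in front cancels the integral of the kernel's modulus exactly, leaving the
  constant 3. The bound holds at every point of the disc, so uniform limits can be controlled near
  the circle.\<close>

lemma norm_bergman_op_le:
  assumes \<phi>: "ess_bounded \<phi>" and B: "AE z in dA. cmod (\<phi> z) \<le> B" and w: "cmod w < 1"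
  shows "cmod (bergman_op \<phi> w) \<le> 3 * B"
proof -
  have pos: "0 < 1 - (cmod w)\<^sup>2"
    using w by (simp add: abs_square_less_1)
  have "cmod (\<integral>z. \<phi> z / (1 - w * cnj z) ^ 4 \<partial>dA) \<le> (\<integral>z. B * (1 / cmod (1 - w * cnj z) ^ 4) \<partial>dA)"
  proof (rule integral_norm_bound_AE)
    show "integrable dA (\<lambda>z. \<phi> z / (1 - w * cnj z) ^ 4)"
      by (intro integrable_dA_kernel ess_bounded_integrable \<phi> w)
    show "integrable dA (\<lambda>z. B * (1 / cmod (1 - w * cnj z) ^ 4))"
      by (intro integrable_mult_right integrable_dA_kernel_norm w)
    show "AE z in dA. cmod (\<phi> z / (1 - w * cnj z) ^ 4) \<le> B * (1 / cmod (1 - w * cnj z) ^ 4)"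
      using B by eventually_elim (auto simp: norm_divide norm_power intro: divide_right_mono)
  qed
  also have "\<dots> = B / (1 - (cmod w)\<^sup>2)\<^sup>2"
    unfolding integral_mult_right_zero integral_dA_kernel_norm[OF w] by simp
  finally have "cmod (\<integral>z. \<phi> z / (1 - w * cnj z) ^ 4 \<partial>dA) * (1 - (cmod w)\<^sup>2)\<^sup>2 \<le> B"
    using pos by (simp add: pos_le_divide_eq)
  moreover have "cmod (bergman_op \<phi> w)
    = 3 * (1 - (cmod w)\<^sup>2)\<^sup>2 * cmod (\<integral>z. \<phi> z / (1 - w * cnj z) ^ 4 \<partial>dA)"
    unfolding bergman_op_def norm_mult norm_of_real norm_numeral abs_power2 ..
  ultimately show ?thesis
    by (simp only: mult_ac)
qed

lemma bergman_op_linear: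
  assumes "ess_bounded \<phi>" "ess_bounded \<psi>" "cmod w < 1"
  shows "bergman_op (\<lambda>z. \<phi> z + \<psi> z) w = bergman_op \<phi> w + bergman_op \<psi> w"
    and "bergman_op (\<lambda>z. c * \<phi> z) w = c * bergman_op \<phi> w"
proof -
  have "integrable dA (\<lambda>z. \<phi> z / (1 - w * cnj z) ^ 4)" "integrable dA (\<lambda>z. \<psi> z / (1 - w * cnj z) ^ 4)"
    using assms by (auto intro: integrable_dA_kernel ess_bounded_integrable)
  then show "bergman_op (\<lambda>z. \<phi> z + \<psi> z) w = bergman_op \<phi> w + bergman_op \<psi> w"
    by (simp add: bergman_op_def add_divide_distrib distrib_left)
  show "bergman_op (\<lambda>z. c * \<phi> z) w = c * bergman_op \<phi> w"
    unfolding bergman_op_def times_divide_eq_right[symmetric] integral_mult_right_zero by simp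
qed

lemma bergman_op_cong_AE:
  assumes "ess_bounded \<phi>" "ess_bounded \<psi>" "AE z in dA. \<phi> z = \<psi> z"
  shows "bergman_op \<phi> w = bergman_op \<psi> w"
proof -
  have [measurable]: "\<phi> \<in> borel_measurable dA" "\<psi> \<in> borel_measurable dA" "cnj \<in> borel_measurable dA"
    using assms by (auto intro: ess_bounded_measurable borel_measurable_dA)
  have "(\<integral>z. \<phi> z / (1 - w * cnj z) ^ 4 \<partial>dA) = (\<integral>z. \<psi> z / (1 - w * cnj z) ^ 4 \<partial>dA)"
  proof (rule integral_cong_AE)
    show "AE z in dA. \<phi> z / (1 - w * cnj z) ^ 4 = \<psi> z / (1 - w * cnj z) ^ 4"
      using assms(3) by eventually_elim simp
  qed measurable
  then show ?thesis by (simp add: bergman_op_def)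
qed

text \<open>The integral alone is a power series in \<open>w\<close>, hence holomorphic; the weight
  in front is continuous.\<close>

lemma bergman_op_continuous_on_disc:
  assumes "ess_bounded \<phi>"
  shows "continuous_on unit_disc (bergman_op \<phi>)"
proof -
  define b where "b = (\<lambda>n. of_nat (n + 3 choose 3) * (\<integral>z. \<phi> z * cnj z ^ n \<partial>dA))"
  have "(\<lambda>n. b n * (w - 0) ^ n) sums (\<integral>z. \<phi> z / (1 - w * cnj z) ^ 4 \<partial>dA)" if "w \<in> unit_disc" for w
    using integral_dA_kernel_sums[OF ess_bounded_integrable[OF assms], of w 3] that by (simp add: b_def)
  then have "(\<lambda>w. \<integral>z. \<phi> z / (1 - w * cnj z) ^ 4 \<partial>dA) holomorphic_on unit_disc"
    by (rule power_series_holomorphic)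
  then show ?thesis
    unfolding bergman_op_def [abs_def]
    by (intro continuous_intros holomorphic_on_imp_continuous_on)
qed

lemma bergman_op_annihilator:
  assumes \<psi>: "ess_bounded \<psi>" and perp: "\<And>f. f \<in> bergman_A1 \<Longrightarrow> (\<integral>z. f z * cnj (\<psi> z) \<partial>dA) = 0"
    and w: "cmod w < 1"
  shows "bergman_op \<psi> w = 0"
proof -
  \<comment> \<open>The conjugate of the kernel belongs to the Bergman space, and its pairing with
    \<open>\<psi>\<close> is the conjugate of the integral in \<open>bergman_op\<close>.\<close>
  define f where "f = (\<lambda>z. 1 / (1 - cnj w * z) ^ 4)"
  have f_cnj: "f = (\<lambda>z. cnj (1 / (1 - w * cnj z) ^ 4))"
    by (simp add: f_def)
  have "integrable dA f"
    unfolding f_cnj complex_integrable_cnj by (rule integrable_dA_kernel[OF _ w]) simp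
  moreover have "f holomorphic_on unit_disc"
  proof -
    have "1 - cnj w * z \<noteq> 0" if "z \<in> unit_disc" for z
      using kernel_denominator_ge[of "cnj w" "cnj z"] that w by auto
    then show ?thesis
      unfolding f_def by (intro holomorphic_intros) auto
  qed
  ultimately have "(\<integral>z. f z * cnj (\<psi> z) \<partial>dA) = 0"
    by (intro perp) (simp add: bergman_A1_def)
  also have "(\<lambda>z. f z * cnj (\<psi> z)) = (\<lambda>z. cnj (\<psi> z / (1 - w * cnj z) ^ 4))"
    by (simp add: f_def)
  finally show ?thesis
    by (simp add: bergman_op_def del: complex_cnj_divide)
qed

text \<open>Both sides are three times the double integral of \<open>k\<close>: integrating over
  \<open>w\<close> first gives the reproducing formula for \<open>f\<close>, integrating over
  \<open>z\<close> first gives the operator applied to \<open>\<phi>\<close>.\<close>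

lemma bergman_op_reproducing_dual:
  assumes \<phi>: "ess_bounded \<phi>" and f: "f \<in> bergman_A1"
  shows "(\<integral>w. f w * cnj (bergman_op \<phi> w) \<partial>dA) = (\<integral>z. f z * cnj (\<phi> z) \<partial>dA)"
proof -
  interpret P: pair_sigma_finite dA dA ..
  have int: "integrable dA f" and hol: "f holomorphic_on unit_disc"
    using f by (auto simp: bergman_A1_def)
  define W where "W = (\<lambda>w. (1 - (cmod w)\<^sup>2)\<^sup>2)"
  define k where "k = (\<lambda>w z. f w * of_real (W w) * (cnj (\<phi> z) / (1 - z * cnj w) ^ 4))"
  define B where "B = enn2real (ess_norm \<phi>)"
  have B: "AE z in dA. cmod (\<phi> z) \<le> B"
    unfolding B_def by (rule ess_norm_AE[OF \<phi>])
  have [measurable]: "\<phi> \<in> borel_measurable dA" "f \<in> borel_measurable dA"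
    using \<phi> int by (auto intro: ess_bounded_measurable)
  have [measurable]: "(\<lambda>z. z) \<in> borel_measurable dA" "W \<in> borel_measurable dA"
    unfolding W_def by (rule borel_measurable_dA, measurable)+
  have swap: "cmod (1 - z * cnj w) = cmod (1 - w * cnj z)" for z w
    using complex_mod_cnj[of "1 - z * cnj w"] by (simp add: mult.commute)
  have int_k: "integrable dA (k w)" if "w \<in> space dA" for w
  proof -
    have "integrable dA (\<lambda>z. cnj (\<phi> z / (1 - w * cnj z) ^ 4))"
      unfolding complex_integrable_cnj
      using that by (intro integrable_dA_kernel ess_bounded_integrable \<phi>) auto
    then show ?thesis
      unfolding k_def by (intro integrable_mult_right) (simp add: mult.commute)
  qed
  \<comment> \<open>The weight cancels the mass of the kernel, leaving a multiple of
    \<open>norm (f w)\<close>. This integrable bound is what justifies Fubini's theorem.\<close>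
  have norm_k: "(\<integral>z. norm (k w z) \<partial>dA) \<le> norm (B * norm (f w))" if w: "w \<in> space dA" for w
  proof -
    have w': "cmod w < 1" using w by simp
    have pos: "0 < W w"
      using w' by (simp add: W_def power_less_one_iff abs_square_eq_1)
    have "(\<integral>z. norm (k w z) \<partial>dA) \<le> (\<integral>z. norm (f w) * W w * B * (1 / cmod (1 - w * cnj z) ^ 4) \<partial>dA)"
    proof (rule integral_mono_AE)
      show "integrable dA (\<lambda>z. norm (k w z))"
        using int_k[OF w] by (rule integrable_norm)
      show "integrable dA (\<lambda>z. norm (f w) * W w * B * (1 / cmod (1 - w * cnj z) ^ 4))"
        by (intro integrable_mult_right integrable_dA_kernel_norm w')
      show "AE z in dA. norm (k w z) \<le> norm (f w) * W w * B * (1 / cmod (1 - w * cnj z) ^ 4)"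
        using B
      proof eventually_elim
        case (elim z)
        then have "norm (f w) * W w * (cmod (\<phi> z) * (1 / cmod (1 - w * cnj z) ^ 4))
          \<le> norm (f w) * W w * (B * (1 / cmod (1 - w * cnj z) ^ 4))"
          using pos by (intro mult_left_mono mult_right_mono) auto
        then show ?case
          using pos by (simp add: k_def norm_mult norm_divide norm_power swap mult_ac)
      qed
    qed
    also have "\<dots> = norm (f w) * W w * B * (1 / (1 - (cmod w)\<^sup>2)\<^sup>2)"
      unfolding integral_mult_right_zero integral_dA_kernel_norm[OF w'] ..
    also have "\<dots> = B * norm (f w)"
      using pos by (simp add: W_def)
    finally show ?thesis by simp
  qed
  have "integrable (dA \<Otimes>\<^sub>M dA) (case_prod k)"
  proof (rule P.Fubini_integrable)
    show "case_prod k \<in> borel_measurable (dA \<Otimes>\<^sub>M dA)"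
      unfolding k_def by measurable
    then have meas: "(\<lambda>w. \<integral>z. norm (k w z) \<partial>dA) \<in> borel_measurable dA"
      by measurable
    have "integrable dA (\<lambda>w. \<integral>z. norm (k w z) \<partial>dA)"
    proof (rule Bochner_Integration.integrable_bound[OF _ meas])
      show "integrable dA (\<lambda>w. B * norm (f w))"
        by (intro integrable_mult_right integrable_norm int)
      show "AE w in dA. norm (\<integral>z. norm (k w z) \<partial>dA) \<le> norm (B * norm (f w))"
        by (rule AE_I2, subst real_norm_def, subst abs_of_nonneg) (use norm_k in auto)
    qed
    then show "integrable dA (\<lambda>w. \<integral>z. norm (case_prod k (w, z)) \<partial>dA)"
      by simp
    show "AE w in dA. integrable dA (\<lambda>z. case_prod k (w, z))"
      using int_k by (intro AE_I2) auto
  qed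
  then have swap_k: "(\<integral>z. (\<integral>w. k w z \<partial>dA) \<partial>dA) = (\<integral>w. (\<integral>z. k w z \<partial>dA) \<partial>dA)"
    by (rule P.Fubini_integral)
  have k_left: "3 * (\<integral>w. k w z \<partial>dA) = f z * cnj (\<phi> z)" if "z \<in> space dA" for z
  proof -
    have "integrable dA (\<lambda>w. f w * of_real ((1 - (cmod w)\<^sup>2)\<^sup>2))"
    proof (rule Bochner_Integration.integrable_bound[OF int])
      show "AE w in dA. norm (f w * of_real ((1 - (cmod w)\<^sup>2)\<^sup>2)) \<le> norm (f w)"
      proof (rule AE_I2)
        fix w assume "w \<in> space dA"
        then have "(1 - (cmod w)\<^sup>2)\<^sup>2 \<le> 1"
          by (intro power_le_one) (auto simp: abs_square_le_1)
        then have "norm (f w) * (1 - (cmod w)\<^sup>2)\<^sup>2 \<le> norm (f w) * 1"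
          by (intro mult_left_mono) auto
        then show "norm (f w * of_real ((1 - (cmod w)\<^sup>2)\<^sup>2)) \<le> norm (f w)"
          by (simp only: norm_mult norm_of_real) simp
      qed
      have "(\<lambda>w. f w * of_real (W w)) \<in> borel_measurable dA"
        by measurable
      then show "(\<lambda>w. f w * of_real ((1 - (cmod w)\<^sup>2)\<^sup>2)) \<in> borel_measurable dA"
        by (simp only: W_def)
    qed
    from weighted_reproducing[OF hol this, of z] that
    have "f z = 3 * (\<integral>w. f w * of_real (W w) / (1 - z * cnj w) ^ 4 \<partial>dA)"
      by (simp add: W_def)
    moreover have "k w z = cnj (\<phi> z) * (f w * of_real (W w) / (1 - z * cnj w) ^ 4)" for w
      by (simp add: k_def)
    ultimately show ?thesis
      by (simp only: integral_mult_right_zero) simp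
  qed
  have k_right: "3 * (\<integral>z. k w z \<partial>dA) = f w * cnj (bergman_op \<phi> w)" for w
  proof -
    have "k w z = f w * of_real (W w) * cnj (\<phi> z / (1 - w * cnj z) ^ 4)" for z
      by (simp add: k_def mult.commute)
    then have "(\<integral>z. k w z \<partial>dA) = f w * of_real (W w) * cnj (\<integral>z. \<phi> z / (1 - w * cnj z) ^ 4 \<partial>dA)"
      by (simp only: integral_mult_right_zero Bochner_Integration.integral_cnj)
    then show ?thesis
      by (simp add: bergman_op_def W_def)
  qed
  have "(\<integral>w. f w * cnj (bergman_op \<phi> w) \<partial>dA) = 3 * (\<integral>w. (\<integral>z. k w z \<partial>dA) \<partial>dA)"
    unfolding k_right[symmetric] by (rule integral_mult_right_zero)
  also have "\<dots> = (\<integral>z. 3 * (\<integral>w. k w z \<partial>dA) \<partial>dA)"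
    unfolding swap_k[symmetric] by (rule integral_mult_right_zero[symmetric])
  also have "\<dots> = (\<integral>z. f z * cnj (\<phi> z) \<partial>dA)"
    by (rule Bochner_Integration.integral_cong[OF refl k_left])
  finally show ?thesis .
qed

section \<open>Behaviour of the operator near the unit circle\<close>

text \<open>The squares of the two sides differ by \<open>(1 - |w|^2) * (1 - |z|^2)\<close>. The
  kernel therefore stays bounded when \<open>z\<close> keeps a fixed distance from \<open>w\<close>,
  even as \<open>w\<close> approaches the circle.\<close>

lemma norm_diff_le_kernel_denominator:
  assumes "cmod w \<le> 1" "cmod z \<le> 1"
  shows "cmod (w - z) \<le> cmod (1 - w * cnj z)"
proof -
  have "complex_of_real ((cmod (1 - w * cnj z))\<^sup>2) = of_real ((cmod (w - z))\<^sup>2 + (1 - (cmod w)\<^sup>2) * (1 - (cmod z)\<^sup>2))"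
    unfolding of_real_add of_real_mult of_real_diff complex_norm_square by (simp add: algebra_simps)
  then have "(cmod (1 - w * cnj z))\<^sup>2 = (cmod (w - z))\<^sup>2 + (1 - (cmod w)\<^sup>2) * (1 - (cmod z)\<^sup>2)"
    by (simp only: of_real_eq_iff)
  moreover have "0 \<le> (1 - (cmod w)\<^sup>2) * (1 - (cmod z)\<^sup>2)"
    using assms by (intro mult_nonneg_nonneg) (auto simp: abs_square_le_1)
  ultimately have "(cmod (w - z))\<^sup>2 \<le> (cmod (1 - w * cnj z))\<^sup>2"
    by simp
  then show ?thesis
    by (rule power2_le_imp_le) simp
qed

definition vanishes_at_circle :: "(complex \<Rightarrow> complex) \<Rightarrow> bool"
  where "vanishes_at_circle g \<longleftrightarrow> (\<forall>\<epsilon>>0. \<exists>r<1. \<forall>w. r < cmod w \<longrightarrow> cmod w < 1 \<longrightarrow> cmod (g w) < \<epsilon>)"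

text \<open>Write \<open>\<phi> z\<close> as \<open>\<phi> w\<close> plus a difference. The constant
  contributes a multiple of the weight, since the kernel has integral 1. The difference is small for
  \<open>z\<close> near \<open>w\<close> by uniform continuity, and elsewhere the kernel is bounded,
  so that this contribution too is killed by the weight.\<close>

lemma bergman_op_continuous_vanishes:
  assumes \<phi>: "continuous_on (cball 0 1) \<phi>"
  shows "vanishes_at_circle (bergman_op \<phi>)"
  unfolding vanishes_at_circle_def
proof (intro allI impI)
  fix \<epsilon> :: real assume \<epsilon>: "\<epsilon> > 0"
  have eb: "ess_bounded \<phi>"
    by (rule ess_bounded_continuous[OF \<phi>])
  have "bounded (\<phi> ` cball 0 1)"
    using \<phi> by (intro compact_imp_bounded compact_continuous_image) auto
  then obtain M where M0: "M > 0" and M: "\<And>z. cmod z \<le> 1 \<Longrightarrow> cmod (\<phi> z) \<le> M"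
    unfolding bounded_pos by auto
  have "uniformly_continuous_on (cball 0 1) \<phi>"
    using \<phi> by (intro compact_uniformly_continuous) auto
  \<comment> \<open>The operator costs a factor 3, so \<open>\<epsilon> / 6\<close> leads to
    \<open>\<epsilon> / 2\<close> for the part near \<open>w\<close>.\<close>
  moreover have "\<epsilon> / 6 > 0" using \<epsilon> by simp
  ultimately obtain \<delta> where \<delta>: "\<delta> > 0"
    and "\<forall>x\<in>cball 0 1. \<forall>x'\<in>cball 0 1. dist x' x < \<delta> \<longrightarrow> dist (\<phi> x') (\<phi> x) < \<epsilon> / 6"
    unfolding uniformly_continuous_on_def by blast
  then have unif: "cmod (\<phi> z - \<phi> w) < \<epsilon> / 6" if "cmod z \<le> 1" "cmod w \<le> 1" "cmod (z - w) < \<delta>" for z w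
    using that by (auto simp: dist_norm)
  \<comment> \<open>The first summand comes from the points \<open>z\<close> at distance at least
    \<open>\<delta>\<close> from \<open>w\<close>, the second from the constant
    \<open>\<phi> w\<close>; 3 is the factor in the operator.\<close>
  define K where "K = 3 * (2 * M / \<delta> ^ 4 + M)"
  have K: "K > 0"
    using M0 \<delta> by (simp add: K_def add_pos_pos)
  have bound: "cmod (bergman_op \<phi> w) \<le> \<epsilon> / 2 + K * (1 - (cmod w)\<^sup>2)\<^sup>2" if w: "cmod w < 1" for w
  proof -
    define k where "k = (\<lambda>z. (1 - w * cnj z) ^ 4)"
    define V where "V = (1 - (cmod w)\<^sup>2)\<^sup>2"
    have V: "V > 0"
      using w by (simp add: V_def power_less_one_iff abs_square_eq_1)
    have int1: "integrable dA (\<lambda>z. 1 / k z)" "integrable dA (\<lambda>z. \<phi> z / k z)"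
      unfolding k_def using integrable_dA_kernel[of "\<lambda>_. 1" w 4] w
      by (auto intro: integrable_dA_kernel[OF ess_bounded_integrable[OF eb]])
    have diff_eq: "(\<lambda>z. (\<phi> z - \<phi> w) / k z) = (\<lambda>z. \<phi> z / k z - \<phi> w * (1 / k z))"
      by (simp add: diff_divide_distrib)
    have "(\<integral>z. (\<phi> z - \<phi> w) / k z \<partial>dA) = (\<integral>z. \<phi> z / k z - \<phi> w * (1 / k z) \<partial>dA)"
      by (simp only: diff_eq)
    also have "\<dots> = (\<integral>z. \<phi> z / k z \<partial>dA) - \<phi> w * (\<integral>z. 1 / k z \<partial>dA)"
      by (simp only: Bochner_Integration.integral_diff[OF int1(2) integrable_mult_right[OF int1(1)]]
        integral_mult_right_zero)
    also have "(\<integral>z. 1 / k z \<partial>dA) = 1"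
      using integral_dA_kernel_one[OF w, of 3] by (simp add: k_def)
    finally have split: "(\<integral>z. \<phi> z / k z \<partial>dA) = (\<integral>z. (\<phi> z - \<phi> w) / k z \<partial>dA) + \<phi> w"
      by simp
    have "cmod (\<integral>z. (\<phi> z - \<phi> w) / k z \<partial>dA) \<le> (\<integral>z. \<epsilon> / 6 * (1 / cmod (1 - w * cnj z) ^ 4) + 2 * M / \<delta> ^ 4 \<partial>dA)"
    proof (rule integral_norm_bound_AE)
      show "integrable dA (\<lambda>z. (\<phi> z - \<phi> w) / k z)"
        unfolding diff_eq by (intro Bochner_Integration.integrable_diff integrable_mult_right int1)
      show "integrable dA (\<lambda>z. \<epsilon> / 6 * (1 / cmod (1 - w * cnj z) ^ 4) + 2 * M / \<delta> ^ 4)"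
        by (intro Bochner_Integration.integrable_add integrable_mult_right integrable_dA_kernel_norm w) simp
      show "AE z in dA. cmod ((\<phi> z - \<phi> w) / k z) \<le> \<epsilon> / 6 * (1 / cmod (1 - w * cnj z) ^ 4) + 2 * M / \<delta> ^ 4"
      proof (rule AE_I2)
        fix z assume "z \<in> space dA"
        then have z: "cmod z < 1" by simp
        have eq: "cmod ((\<phi> z - \<phi> w) / k z) = cmod (\<phi> z - \<phi> w) * (1 / cmod (1 - w * cnj z) ^ 4)"
          by (simp add: k_def norm_divide norm_power)
        show "cmod ((\<phi> z - \<phi> w) / k z) \<le> \<epsilon> / 6 * (1 / cmod (1 - w * cnj z) ^ 4) + 2 * M / \<delta> ^ 4"
        proof (cases "cmod (z - w) < \<delta>")
          case True
          then have "cmod (\<phi> z - \<phi> w) * (1 / cmod (1 - w * cnj z) ^ 4) \<le> \<epsilon> / 6 * (1 / cmod (1 - w * cnj z) ^ 4)"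
            using unif[of z w] z w by (intro mult_right_mono) auto
          moreover have "0 \<le> 2 * M / \<delta> ^ 4"
            using M0 by simp
          ultimately show ?thesis unfolding eq by linarith
        next
          case False
          then have "\<delta> \<le> cmod (1 - w * cnj z)"
            using norm_diff_le_kernel_denominator[of w z] z w by (simp add: norm_minus_commute)
          then have "1 / cmod (1 - w * cnj z) ^ 4 \<le> 1 / \<delta> ^ 4"
            using \<delta> by (intro divide_left_mono power_mono mult_pos_pos zero_less_power) auto
          moreover have "cmod (\<phi> z - \<phi> w) \<le> 2 * M"
            using norm_triangle_ineq4[of "\<phi> z" "\<phi> w"] M[of z] M[of w] z w by simp
          ultimately have "cmod (\<phi> z - \<phi> w) * (1 / cmod (1 - w * cnj z) ^ 4) \<le> 2 * M * (1 / \<delta> ^ 4)"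
            using M0 by (intro mult_mono) auto
          moreover have "0 \<le> \<epsilon> / 6 * (1 / cmod (1 - w * cnj z) ^ 4)"
            using \<epsilon> by simp
          ultimately show ?thesis unfolding eq by simp
        qed
      qed
    qed
    also have "\<dots> = \<epsilon> / 6 * (1 / V) + 2 * M / \<delta> ^ 4"
    proof -
      have "measure dA unit_disc = 1"
        by (simp add: measure_def emeasure_dA_disc)
      then show ?thesis
        using integrable_dA_kernel_norm[OF w, of 4]
        by (subst Bochner_Integration.integral_add)
          (auto simp: integral_dA_kernel_norm[OF w, simplified] V_def simp del: times_divide_eq_right intro!: integrable_mult_right)
    qed
    finally have "cmod (\<integral>z. \<phi> z / k z \<partial>dA) \<le> \<epsilon> / 6 * (1 / V) + 2 * M / \<delta> ^ 4 + M"
      unfolding split using norm_triangle_ineq[of "\<integral>z. (\<phi> z - \<phi> w) / k z \<partial>dA" "\<phi> w"] M[of w] w by linarith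
    then have "3 * V * cmod (\<integral>z. \<phi> z / k z \<partial>dA) \<le> 3 * V * (\<epsilon> / 6 * (1 / V) + 2 * M / \<delta> ^ 4 + M)"
      using V by (intro mult_left_mono) auto
    also have "\<dots> = \<epsilon> / 2 + K * V"
      unfolding K_def distrib_left using V by (simp add: algebra_simps)
    also have "3 * V * cmod (\<integral>z. \<phi> z / k z \<partial>dA) = cmod (bergman_op \<phi> w)"
      unfolding bergman_op_def norm_mult k_def V_def norm_of_real norm_numeral abs_power2 ..
    finally show ?thesis
      unfolding V_def .
  qed
  \<comment> \<open>Solves \<open>K * (1 - r^2)^2 = \<epsilon> / 2\<close> for \<open>r\<close> when
    a solution in the unit interval exists; the maximum with 0 covers large
    \<open>\<epsilon>\<close> and keeps \<open>r\<close> nonnegative for the squaring below.\<close>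
  define r where "r = sqrt (max 0 (1 - sqrt (\<epsilon> / (2 * K))))"
  have "r < 1"
    using \<epsilon> K by (simp add: r_def)
  moreover have "cmod (bergman_op \<phi> w) < \<epsilon>" if "r < cmod w" "cmod w < 1" for w
  proof -
    have "r\<^sup>2 < (cmod w)\<^sup>2"
      using that(1) by (intro power_strict_mono) (auto simp: r_def)
    then have "1 - sqrt (\<epsilon> / (2 * K)) < (cmod w)\<^sup>2"
      by (simp add: r_def)
    moreover have "(cmod w)\<^sup>2 < 1"
      using that(2) by (simp add: abs_square_less_1)
    ultimately have "(1 - (cmod w)\<^sup>2)\<^sup>2 < (sqrt (\<epsilon> / (2 * K)))\<^sup>2"
      by (intro power_strict_mono) auto
    also have "\<dots> = \<epsilon> / (2 * K)"
      using \<epsilon> K by simp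
    finally have "K * (1 - (cmod w)\<^sup>2)\<^sup>2 < K * (\<epsilon> / (2 * K))"
      using K by (rule mult_strict_left_mono)
    also have "\<dots> = \<epsilon> / 2"
      using K by simp
    finally have "K * (1 - (cmod w)\<^sup>2)\<^sup>2 < \<epsilon> / 2" .
    then show ?thesis
      using bound[OF that(2)] by linarith
  qed
  ultimately show "\<exists>r<1. \<forall>w. r < cmod w \<longrightarrow> cmod w < 1 \<longrightarrow> cmod (bergman_op \<phi> w) < \<epsilon>"
    by blast
qed

lemma continuous_on_cball_if_vanishes_at_circle:
  assumes "continuous_on unit_disc g" "vanishes_at_circle g" "\<And>w. cmod w = 1 \<Longrightarrow> g w = 0"
  shows "continuous_on (cball 0 1) g"
  unfolding continuous_on_def
proof
  fix x :: complex assume "x \<in> cball 0 1"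
  then have "cmod x \<le> 1" by simp
  then consider "cmod x < 1" | "cmod x = 1" by linarith
  then show "(g \<longlongrightarrow> g x) (at x within cball 0 1)"
  proof cases
    case 1
    then have "x \<in> unit_disc" by simp
    then have "isCont g x"
      using assms(1) by (simp add: continuous_on_eq_continuous_at)
    then show ?thesis
      unfolding isCont_def by (rule tendsto_within_subset) simp
  next
    case 2
    show ?thesis
      unfolding assms(3)[OF 2] tendsto_iff dist_0_norm
    proof (intro allI impI)
      fix \<epsilon> :: real assume \<epsilon>: "0 < \<epsilon>"
      then obtain r where r: "r < 1" "\<And>w. r < cmod w \<Longrightarrow> cmod w < 1 \<Longrightarrow> cmod (g w) < \<epsilon>"
        using assms(2) unfolding vanishes_at_circle_def by blast
      \<comment> \<open>A point closer than \<open>1 - r\<close> to a point of the circle has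
        modulus greater than \<open>r\<close>.\<close>
      have "cmod (g w) < \<epsilon>" if "w \<in> cball 0 1" "dist w x < 1 - r" for w
      proof (cases "cmod w = 1")
        case False
        moreover have "r < cmod w"
          using that(2) norm_triangle_ineq2[of x w] 2 by (simp add: dist_norm norm_minus_commute)
        ultimately show ?thesis
          using that(1) by (intro r(2)) auto
      qed (use \<epsilon> assms(3) in auto)
      then show "\<forall>\<^sub>F w in at x within cball 0 1. dist (g w) 0 < \<epsilon>"
        unfolding eventually_at using r(1) by (intro exI[of _ "1 - r"]) auto
    qed
  qed
qed

section \<open>The subspace \<open>(A\<^sup>1)\<^sup>\<bottom> + C\<close>\<close>

text \<open>The values are functions rather than classes: the integral depends only on the class of
  its argument, and the limit at the circle needs values at individual points.\<close>

lift_definition bergman_Linf :: "Linf \<Rightarrow> complex \<Rightarrow> complex" is bergman_op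
  by (rule ext) (auto intro: bergman_op_cong_AE dest: Linf_relD)

lemma bergman_Linf_add: "cmod w < 1 \<Longrightarrow> bergman_Linf (\<phi> + \<psi>) w = bergman_Linf \<phi> w + bergman_Linf \<psi> w"
  by transfer (auto intro: bergman_op_linear dest: Linf_relD)

lemma bergman_Linf_scaleC: "cmod w < 1 \<Longrightarrow> bergman_Linf (scaleC_Linf c \<phi>) w = c * bergman_Linf \<phi> w"
  by transfer (auto intro: bergman_op_linear dest: Linf_relD)

lemma norm_bergman_Linf_le: "cmod w < 1 \<Longrightarrow> cmod (bergman_Linf \<phi> w) \<le> 3 * norm \<phi>"
  by transfer (auto intro!: norm_bergman_op_le ess_norm_AE dest: Linf_relD)

lemma bergman_Linf_A1_perp: "\<psi> \<in> A1_perp \<Longrightarrow> cmod w < 1 \<Longrightarrow> bergman_Linf \<psi> w = 0"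
  unfolding A1_perp_def mem_Collect_eq
  by transfer (auto intro: bergman_op_annihilator dest: Linf_relD)

lemma bergman_Linf_abs: "ess_bounded f \<Longrightarrow> bergman_Linf (abs_Linf f) = bergman_op f"
  by (simp add: bergman_Linf.abs_eq Linf_rel_def)

lemma vanishes_at_circle_cong:
  "(\<And>w. cmod w < 1 \<Longrightarrow> f w = g w) \<Longrightarrow> vanishes_at_circle f = vanishes_at_circle g"
  unfolding vanishes_at_circle_def by metis

lemma vanishes_at_circle_add:
  assumes "vanishes_at_circle f" "vanishes_at_circle g"
  shows "vanishes_at_circle (\<lambda>w. f w + g w)"
  unfolding vanishes_at_circle_def
proof (intro allI impI)
  fix \<epsilon> :: real assume "\<epsilon> > 0"
  then have "\<epsilon> / 2 > 0" by simp
  then obtain r where "r < 1" and r: "\<And>w. r < cmod w \<Longrightarrow> cmod w < 1 \<Longrightarrow> cmod (f w) < \<epsilon> / 2"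
    using assms(1) unfolding vanishes_at_circle_def by meson
  obtain s where "s < 1" and s: "\<And>w. s < cmod w \<Longrightarrow> cmod w < 1 \<Longrightarrow> cmod (g w) < \<epsilon> / 2"
    using assms(2) \<open>\<epsilon> / 2 > 0\<close> unfolding vanishes_at_circle_def by meson
  have "cmod (f w + g w) < \<epsilon>" if "max r s < cmod w" "cmod w < 1" for w
    using norm_triangle_ineq[of "f w" "g w"] r[of w] s[of w] that by simp
  then show "\<exists>r<1. \<forall>w. r < cmod w \<longrightarrow> cmod w < 1 \<longrightarrow> cmod (f w + g w) < \<epsilon>"
    using \<open>r < 1\<close> \<open>s < 1\<close> by (intro exI[of _ "max r s"]) auto
qed

lemma vanishes_at_circle_cmult:
  assumes "vanishes_at_circle f"
  shows "vanishes_at_circle (\<lambda>w. c * f w)"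
proof (cases "c = 0")
  case False
  show ?thesis
    unfolding vanishes_at_circle_def
  proof (intro allI impI)
    fix \<epsilon> :: real assume "\<epsilon> > 0"
    then have "\<epsilon> / cmod c > 0" using False by simp
    then obtain r where "r < 1" "\<And>w. r < cmod w \<Longrightarrow> cmod w < 1 \<Longrightarrow> cmod (f w) < \<epsilon> / cmod c"
      using assms unfolding vanishes_at_circle_def by meson
    then show "\<exists>r<1. \<forall>w. r < cmod w \<longrightarrow> cmod w < 1 \<longrightarrow> cmod (c * f w) < \<epsilon>"
      using False by (intro exI[of _ r]) (auto simp: norm_mult field_simps)
  qed
qed (auto simp: vanishes_at_circle_def intro!: exI[of _ 0])

lemma integrable_mult_cnj_ess_bounded:
  assumes "integrable dA h" "ess_bounded f"
  shows "integrable dA (\<lambda>z. h z * cnj (f z))"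
proof (rule Bochner_Integration.integrable_bound)
  have [measurable]: "h \<in> borel_measurable dA" "f \<in> borel_measurable dA"
    using assms by (auto intro: ess_bounded_measurable)
  show "(\<lambda>z. h z * cnj (f z)) \<in> borel_measurable dA"
    by measurable
  show "integrable dA (\<lambda>z. enn2real (ess_norm f) * norm (h z))"
    by (intro integrable_mult_right integrable_norm assms)
  show "AE z in dA. norm (h z * cnj (f z)) \<le> norm (enn2real (ess_norm f) * norm (h z))"
    using ess_norm_AE[OF assms(2)]
    by eventually_elim (simp add: norm_mult abs_mult mult.commute mult_right_mono)
qed

text \<open>Linearity, closedness and properness are all read off from the right-hand side. An
  element of the sum has the same image as its continuous summand. Conversely, an element splits
  into its image, continuous on the closed disc by the vanishing condition, and a remainder in the
  annihilator.\<close>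

lemma A1_perp_plus_C_eq: "A1_perp + C_closed_disc = {\<phi>. vanishes_at_circle (bergman_Linf \<phi>)}"
proof (intro equalityI subsetI CollectI)
  fix \<phi> assume "\<phi> \<in> A1_perp + C_closed_disc"
  then obtain \<psi> g where \<psi>: "\<psi> \<in> A1_perp" and g: "continuous_on (cball 0 1) g"
    and \<phi>: "\<phi> = \<psi> + abs_Linf g"
    by (auto simp: C_closed_disc_def elim!: set_plus_elim)
  have "bergman_Linf \<phi> w = bergman_op g w" if "cmod w < 1" for w
    unfolding \<phi> bergman_Linf_add[OF that] bergman_Linf_A1_perp[OF \<psi> that]
    by (simp add: bergman_Linf_abs ess_bounded_continuous[OF g])
  then show "vanishes_at_circle (bergman_Linf \<phi>)"
    using bergman_op_continuous_vanishes[OF g] vanishes_at_circle_cong by blast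
next
  fix \<phi> assume "\<phi> \<in> {\<phi>. vanishes_at_circle (bergman_Linf \<phi>)}"
  then have van: "vanishes_at_circle (bergman_Linf \<phi>)" by simp
  obtain f where f: "ess_bounded f" and \<phi>: "\<phi> = abs_Linf f"
    by (induction \<phi> rule: Linf.abs_induct) (auto dest: Linf_relD)
  define g where "g = bergman_op f"
  have "continuous_on (cball 0 1) g"
    unfolding g_def
  proof (rule continuous_on_cball_if_vanishes_at_circle)
    show "vanishes_at_circle (bergman_op f)"
      using van by (simp add: \<phi> bergman_Linf_abs f)
    show "bergman_op f w = 0" if "cmod w = 1" for w
      using that by (simp add: bergman_op_def)
  qed (rule bergman_op_continuous_on_disc[OF f])
  then have g: "ess_bounded g" "abs_Linf g \<in> C_closed_disc"
    by (auto simp: C_closed_disc_def ess_bounded_continuous)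
  have eq: "\<phi> - abs_Linf g = abs_Linf (\<lambda>z. f z - g z)"
    unfolding \<phi> by (rule minus_Linf.abs_eq) (use f g in \<open>auto simp: Linf_rel_def\<close>)
  have "annihilates_A1 (abs_Linf (\<lambda>z. f z - g z))"
  proof (subst annihilates_A1.abs_eq)
    show "Linf_rel (\<lambda>z. f z - g z) (\<lambda>z. f z - g z)"
      using ess_bounded_diff[OF f g(1)] by (simp add: Linf_rel_def)
    show "\<forall>h\<in>bergman_A1. (LINT z|dA. h z * cnj (f z - g z)) = 0"
    proof
      fix h assume h: "h \<in> bergman_A1"
      then have "integrable dA h" by (simp add: bergman_A1_def)
      then have "integrable dA (\<lambda>z. h z * cnj (f z))" "integrable dA (\<lambda>z. h z * cnj (g z))"
        using integrable_mult_cnj_ess_bounded f g(1) by blast+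
      then have "(LINT z|dA. h z * cnj (f z - g z)) = (LINT z|dA. h z * cnj (f z)) - (LINT z|dA. h z * cnj (g z))"
        by (simp add: right_diff_distrib)
      also have "\<dots> = 0"
        using bergman_op_reproducing_dual[OF f h] by (simp add: g_def)
      finally show "(LINT z|dA. h z * cnj (f z - g z)) = 0" .
    qed
  qed
  then have "\<phi> - abs_Linf g \<in> A1_perp"
    by (simp add: eq A1_perp_def)
  from set_plus_intro[OF this g(2)] show "\<phi> \<in> A1_perp + C_closed_disc"
    by simp
qed

lemma subspace_A1_perp_plus_C: "Linf.subspace (A1_perp + C_closed_disc)"
  unfolding A1_perp_plus_C_eq
proof (rule Linf.subspaceI)
  have "bergman_Linf 0 w = 0" if "cmod w < 1" for w
    using norm_bergman_Linf_le[OF that, of 0] by simp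
  then show "0 \<in> {\<phi>. vanishes_at_circle (bergman_Linf \<phi>)}"
    by (auto simp: vanishes_at_circle_def intro!: exI[of _ 0])
next
  fix \<phi> \<psi> assume "\<phi> \<in> {\<phi>. vanishes_at_circle (bergman_Linf \<phi>)}" "\<psi> \<in> {\<phi>. vanishes_at_circle (bergman_Linf \<phi>)}"
  then show "\<phi> + \<psi> \<in> {\<phi>. vanishes_at_circle (bergman_Linf \<phi>)}"
    using vanishes_at_circle_cong[OF bergman_Linf_add[of _ \<phi> \<psi>]] vanishes_at_circle_add by auto
next
  fix c \<phi> assume "\<phi> \<in> {\<phi>. vanishes_at_circle (bergman_Linf \<phi>)}"
  then show "scaleC_Linf c \<phi> \<in> {\<phi>. vanishes_at_circle (bergman_Linf \<phi>)}"
    using vanishes_at_circle_cong[OF bergman_Linf_scaleC[of _ c \<phi>]] vanishes_at_circle_cmult by auto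
qed

lemma closed_A1_perp_plus_C: "closed (A1_perp + C_closed_disc)"
  unfolding A1_perp_plus_C_eq closure_subset_eq[symmetric]
proof (intro subsetI CollectI)
  fix \<phi> assume cl: "\<phi> \<in> closure {\<phi>. vanishes_at_circle (bergman_Linf \<phi>)}"
  show "vanishes_at_circle (bergman_Linf \<phi>)"
    unfolding vanishes_at_circle_def
  proof (intro allI impI)
    fix \<epsilon> :: real assume \<epsilon>: "\<epsilon> > 0"
    \<comment> \<open>By the bound with constant 3, an approximation within
      \<open>\<epsilon> / 6\<close> changes the image by less than
      \<open>\<epsilon> / 2\<close>.\<close>
    then have "\<epsilon> / 6 > 0" by simp
    then obtain \<psi> where \<psi>: "vanishes_at_circle (bergman_Linf \<psi>)" and d: "dist \<psi> \<phi> < \<epsilon> / 6"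
      using cl unfolding closure_approachable by blast
    have "\<epsilon> / 2 > 0" using \<epsilon> by simp
    then obtain r where "r < 1" and r: "\<And>w. r < cmod w \<Longrightarrow> cmod w < 1 \<Longrightarrow> cmod (bergman_Linf \<psi> w) < \<epsilon> / 2"
      using \<psi> unfolding vanishes_at_circle_def by meson
    have "cmod (bergman_Linf \<phi> w) < \<epsilon>" if w: "r < cmod w" "cmod w < 1" for w
    proof -
      have "bergman_Linf \<phi> w = bergman_Linf \<psi> w + bergman_Linf (\<phi> - \<psi>) w"
        using bergman_Linf_add[OF w(2), of \<psi> "\<phi> - \<psi>"] by simp
      moreover have "cmod (bergman_Linf (\<phi> - \<psi>) w) \<le> 3 * dist \<psi> \<phi>"
        using norm_bergman_Linf_le[OF w(2), of "\<phi> - \<psi>"] by (simp add: dist_norm norm_minus_commute)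
      ultimately show ?thesis
        using norm_triangle_ineq[of "bergman_Linf \<psi> w" "bergman_Linf (\<phi> - \<psi>) w"] r[OF w] d
        by simp
    qed
    with \<open>r < 1\<close> show "\<exists>r<1. \<forall>w. r < cmod w \<longrightarrow> cmod w < 1 \<longrightarrow> cmod (bergman_Linf \<phi> w) < \<epsilon>"
      by blast
  qed
qed

lemma A1_perp_plus_C_neq_UNIV: "A1_perp + C_closed_disc \<noteq> UNIV"
proof
  \<comment> \<open>The function \<open>f\<close> below is bounded since \<open>1 - |z|\<^sup>2 \<le> 2 |1 - z|\<close>, and it is fixed by the operator,
    but \<open>f t = (1 + t)\<^sup>2\<close> for real \<open>t\<close>, which does not vanish as \<open>t\<close> tends to \<open>1\<close>.\<close>
  assume univ: "A1_perp + C_closed_disc = UNIV"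
  define W where "W = (\<lambda>z. (1 - (cmod z)\<^sup>2)\<^sup>2)"
  define h where "h = (\<lambda>z :: complex. 1 / (1 - z)\<^sup>2)"
  define f where "f = (\<lambda>z. h z * of_real (W z))"
  have bound: "cmod (f z) \<le> 4" if z: "cmod z < 1" for z
  proof -
    have "1 - (cmod z)\<^sup>2 = (1 + cmod z) * (1 - cmod z)"
      by (simp add: power2_eq_square algebra_simps)
    also have "\<dots> \<le> 2 * cmod (1 - z)"
      using z norm_triangle_ineq2[of 1 z] by (intro mult_mono) auto
    finally have "1 - (cmod z)\<^sup>2 \<le> 2 * cmod (1 - z)" .
    moreover have "0 \<le> 1 - (cmod z)\<^sup>2"
      using z by (simp add: abs_square_le_1)
    ultimately have "W z \<le> (2 * cmod (1 - z))\<^sup>2"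
      unfolding W_def by (rule power_mono)
    moreover have "z \<noteq> 1" using z by auto
    ultimately have "W z / (cmod (1 - z))\<^sup>2 \<le> 4"
      by (simp add: divide_le_eq power_mult_distrib)
    moreover have "cmod (f z) = W z / (cmod (1 - z))\<^sup>2"
      unfolding f_def h_def W_def norm_mult norm_divide norm_power norm_of_real norm_one abs_power2
      by simp
    ultimately show ?thesis by simp
  qed
  have f: "ess_bounded f"
  proof (rule ess_boundedI)
    show "f \<in> borel_measurable dA"
      unfolding f_def h_def W_def by (rule borel_measurable_dA) measurable
    show "AE z in dA. cmod (f z) \<le> 4"
      by (rule AE_I2) (use bound in auto)
  qed
  have hol: "h holomorphic_on unit_disc"
    unfolding h_def by (intro holomorphic_intros) auto
  have fixed: "bergman_op f w = f w" if "cmod w < 1" for w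
  proof -
    have "integrable dA (\<lambda>w. h w * of_real ((1 - (cmod w)\<^sup>2)\<^sup>2))"
      using ess_bounded_integrable[OF f] unfolding f_def W_def .
    from weighted_reproducing[OF hol this that]
    have "3 * (\<integral>z. f z / (1 - w * cnj z) ^ 4 \<partial>dA) = h w"
      unfolding f_def W_def .
    then have "of_real (W w) * (3 * (\<integral>z. f z / (1 - w * cnj z) ^ 4 \<partial>dA)) = f w"
      by (simp add: f_def)
    then show ?thesis
      unfolding bergman_op_def W_def by (simp only: mult_ac)
  qed
  have "vanishes_at_circle (bergman_Linf (abs_Linf f))"
    using univ unfolding A1_perp_plus_C_eq by blast
  then have "vanishes_at_circle (bergman_op f)"
    by (simp add: bergman_Linf_abs f)
  then obtain r where r: "r < 1" "\<And>w. r < cmod w \<Longrightarrow> cmod w < 1 \<Longrightarrow> cmod (bergman_op f w) < 1"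
    unfolding vanishes_at_circle_def by (meson zero_less_one)
  \<comment> \<open>A real point between \<open>r\<close> and 1; the maximum with 0 is there because
    \<open>r\<close> may be negative. There the fixed function has modulus \<open>(1 + t)^2\<close>,
    at least 1, against the bound 1 just obtained.\<close>
  define t where "t = max 0 ((r + 1) / 2)"
  have t: "0 \<le> t" "t < 1" "r < t"
    using r(1) by (auto simp: t_def max_def)
  have "cmod (f (of_real t)) = (1 + t)\<^sup>2"
  proof -
    have "f (of_real t) = of_real ((1 - t\<^sup>2)\<^sup>2 / (1 - t)\<^sup>2)"
      using t by (simp add: f_def h_def W_def)
    also have "(1 - t\<^sup>2)\<^sup>2 / (1 - t)\<^sup>2 = (1 + t)\<^sup>2"
    proof -
      have "(1 - t\<^sup>2) = (1 + t) * (1 - t)"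
        by (simp add: power2_eq_square algebra_simps)
      then show ?thesis
        using t by (simp add: power_mult_distrib)
    qed
    finally show ?thesis
      by (simp only: norm_of_real abs_power2)
  qed
  moreover have "1 \<le> (1 + t)\<^sup>2"
    using t by (intro one_le_power) auto
  moreover have "cmod (f (of_real t)) < 1"
    using r(2)[of "of_real t"] fixed[of "of_real t"] t by simp
  ultimately show False by simp
qed

theorem theorem3:
  shows "Linf.subspace (A1_perp + C_closed_disc) \<and>
         closed (A1_perp + C_closed_disc) \<and>
         A1_perp + C_closed_disc \<noteq> UNIV"
  using subspace_A1_perp_plus_C closed_A1_perp_plus_C A1_perp_plus_C_neq_UNIV by blast

end
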